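(* Let $\ell:\mathbb{R}^d\to\mathbb{R}$ be a continuous (coercive) loss function with gap parameter $\Theta_\ell>0$. Then the random-subspace walk algorithm returns, with probability at least $$\left(1-(1-\delta^2)^T\right)\left(1-(1-\Theta_\ell^2/2)^T\right)^n,$$ a point $x_{n+1}\in\mathbb{R}^d$ satisfying $$\ell(x_{n+1})-\alpha_{\min}\ \le\ (1-\delta)\,(1-2^{-1/2}\Theta_\ell)^n\,(\alpha_{\max}-\alpha_{\min}).$$ In particular, the successive differences of loss values satisfy the bounds $$\begin{aligned}\ell(x_n)-\ell(x_{n+1})\ &=\ (\ell(x_n)-\alpha_{\min})-(\ell(x_{n+1})-\alpha_{\min})\\ &\le\ \ell(x_n)-\alpha_{\min}\\ &\le\ (1-\delta)\,(1-2^{-1/2}\Theta_\ell)^{n-1}\,(\alpha_{\max}-\alpha_{\min}),\end{aligned}$$ so that the algorithm terminates within $$n=\left\lceil \frac{\log\left(\frac{\epsilon_a}{(1-\delta)(\alpha_{\max}-\alpha_{\min})}\right)}{\log(1-2^{-1/2}\Theta_\ell)}\right\rceil+1$$ iterations. Moreover, if $$T=\left\lceil \max\left(\frac{\log(1-\frac{1}{\sqrt2})}{\log(1-\delta^2)},\ \frac{\log(1-2^{-1/(2n)})}{\log(1-\Theta_\ell^2/2)}\right)\right\rceil,$$ the probability of success is at least $1/2$.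
   Context: Let $d>k>1$ be integers. $\mathcal G_{k,d}$ is the Grassmannian of $k$-dimensional linear subspaces ("$k$-planes") of $\mathbb{R}^d$, with its canonical $O(d)$-invariant probability measure. For nonzero $x\in\mathbb{R}^d$, $\mathcal G_{k,d,x}=\{\eta\in\mathcal G_{k,d}: x\in\eta\}$, with its unique probability measure invariant under the stabilizer of $x$ in $O(d)$. "Uniformly" refers to these probability measures, as do means and $L^2$-norms on these spaces. The loss function $\ell:\mathbb{R}^d\to\mathbb{R}$ is continuous and coercive, so that it attains a minimum on each $k$-plane. Define $\phi(\eta)=\min_{y\in\eta}\ell(y)$ for $\eta\in\mathcal G_{k,d}$, and let $\alpha_{\max}$ and $\alpha_{\min}$ be the global maximum and minimum values of $\phi$ (so $\alpha_{\min}=\min_{\mathbb{R}^d}\ell$). Let $$\delta=\frac{1}{\sqrt2}\,\frac{\|\phi-\bar\phi\|_2}{\alpha_{\max}-\alpha_{\min}},$$ where $\bar\phi$ is the mean of $\phi$ over $\mathcal G_{k,d}$ and $\|\cdot\|_2$ is the $L^2$-norm on $\mathcal G_{k,d}$. The gap parameter of $\ell$ is $$\Theta_\ell=\inf_x \frac{\left\|\phi|_{\mathcal G_{k,d,x}}-\overline{\phi|_{\mathcal G_{k,d,x}}}\right\|_{2,\mathcal G_{k,d,x}}}{\max(\phi|_{\mathcal G_{k,d,x}})-\min(\phi|_{\mathcal G_{k,d,x}})},$$ where the infimum is taken over all $x$ for which the restriction of $\phi$ to $\mathcal G_{k,d,x}$ is nonconstant, i.e., $x$ which are not already global minimizers of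 $\ell$; the bar denotes the mean over $\mathcal G_{k,d,x}$ and $\|\cdot\|_{2,\mathcal G_{k,d,x}}$ the $L^2$-norm there. Random-subspace walk algorithm. Input: the continuous loss function $\ell$, integers $d>k>1$ and $T\ge1$, an accuracy parameter $\epsilon_a>0$, and a black box $\mathcal B$ which takes a $k$-plane $\eta$ as input and returns a minimizer of $\ell$ restricted to $\eta$. Steps: 1. Set $x_0$ to be some fixed element of $\mathbb{R}^d$, e.g. $0$. 2. Sample $\eta^{(1)},\ldots,\eta^{(T)}$ independently and uniformly at random from $\mathcal G_{k,d}$. 3. Choose any $x_1\in\arg\min_{y\in\{\mathcal B(\eta^{(1)}),\ldots,\mathcal B(\eta^{(T)})\}}\ell(y)$. 4. Let $i=1$. 5. While $\ell(x_{i-1})-\ell(x_i)>\epsilon_a$: sample $\eta^{(1)},\ldots,\eta^{(T)}$ independently and uniformly from $\mathcal G_{k,d,x_i}$; let $x_{i+1}=\arg\min_{y\in\{\mathcal B(\eta^{(1)}),\ldots,\mathcal B(\eta^{(T)})\}}\ell(y)$; replace $i$ by $i+1$. 6. Return $x_i$. *)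

theory Defs
  imports "HOL-Probability.Probability"
begin

definition grassmannian :: "nat \<Rightarrow> (real^'n) set set" where
  "grassmannian k = {\<eta>. subspace \<eta> \<and> dim \<eta> = k}"

definition grassmannian_through :: "nat \<Rightarrow> real^'n \<Rightarrow> (real^'n) set set" where
  "grassmannian_through k x = {\<eta> \<in> grassmannian k. x \<in> \<eta>}"

text \<open>
  The usual topology on the Grassmannian is the one obtained by identifying a subspace \<open>\<eta>\<close>
  with the matrix of the orthogonal projection onto it; on a subspace this projection is
  \<^const>\<open>closest_point\<close>. The following is the Borel sigma-algebra of that topology.
\<close>
definition grassmannian_borel :: "nat \<Rightarrow> (real^'n) set measure" where
  "grassmannian_borel k =
     vimage_algebra (grassmannian k) (\<lambda>\<eta>. matrix (closest_point \<eta>)) borel"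

text \<open>
  \<open>invariant_prob k X G \<mu>\<close>: \<open>\<mu>\<close> is a Borel probability measure on the set \<open>X\<close> of
  \<open>k\<close>-planes that is invariant under the action \<open>\<eta> \<mapsto> f(\<eta>)\<close> of every \<open>f \<in> G\<close>.
\<close>
definition invariant_prob ::
    "nat \<Rightarrow> (real^'n) set set \<Rightarrow> (real^'n \<Rightarrow> real^'n) set \<Rightarrow> (real^'n) set measure \<Rightarrow> bool" where
  "invariant_prob k X G \<mu> \<longleftrightarrow>
     prob_space \<mu> \<and> sets \<mu> = sets (restrict_space (grassmannian_borel k) X) \<and>
     (\<forall>f\<in>G. distr \<mu> \<mu> (\<lambda>\<eta>. f ` \<eta>) = \<mu>)"

text \<open>
  Each group acts transitively, so each of the following two predicates determines its measure
  uniquely. The second one makes sense for \<open>x = 0\<close> too, where it coincides with the first.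
\<close>
definition uniform_grassmannian :: "nat \<Rightarrow> (real^'n) set measure \<Rightarrow> bool" where
  "uniform_grassmannian k \<mu> \<longleftrightarrow>
     invariant_prob k (grassmannian k) {f. orthogonal_transformation f} \<mu>"

definition uniform_grassmannian_through :: "nat \<Rightarrow> real^'n \<Rightarrow> (real^'n) set measure \<Rightarrow> bool" where
  "uniform_grassmannian_through k x \<mu> \<longleftrightarrow>
     invariant_prob k (grassmannian_through k x) {f. orthogonal_transformation f \<and> f x = x} \<mu>"

definition coercive :: "(real^'n \<Rightarrow> real) \<Rightarrow> bool" where
  "coercive l \<longleftrightarrow> filterlim l at_top at_infinity"

text \<open>
  For continuous coercive \<open>l\<close> all the infima and suprema of \<open>l\<close> and of
  \<open>plane_min l\<close> below are attained, i.e. they are minima and maxima.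
\<close>
definition plane_min :: "(real^'n \<Rightarrow> real) \<Rightarrow> (real^'n) set \<Rightarrow> real" where
  "plane_min l \<eta> = (INF y\<in>\<eta>. l y)"

definition alpha_max :: "nat \<Rightarrow> (real^'n \<Rightarrow> real) \<Rightarrow> real" where
  "alpha_max k l = (SUP \<eta>\<in>grassmannian k. plane_min l \<eta>)"

definition alpha_min :: "nat \<Rightarrow> (real^'n \<Rightarrow> real) \<Rightarrow> real" where
  "alpha_min k l = (INF \<eta>\<in>grassmannian k. plane_min l \<eta>)"

definition L2_norm :: "'a measure \<Rightarrow> ('a \<Rightarrow> real) \<Rightarrow> real" where
  "L2_norm M f = sqrt (\<integral>\<eta>. (f \<eta>)\<^sup>2 \<partial>M)"

definition L2_deviation :: "'a measure \<Rightarrow> ('a \<Rightarrow> real) \<Rightarrow> real" where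
  "L2_deviation M f = L2_norm M (\<lambda>\<eta>. f \<eta> - (\<integral>\<zeta>. f \<zeta> \<partial>M))"

definition delta_param :: "nat \<Rightarrow> (real^'n) set measure \<Rightarrow> (real^'n \<Rightarrow> real) \<Rightarrow> real" where
  "delta_param k \<mu> l =
     1 / sqrt 2 * (L2_deviation \<mu> (plane_min l) / (alpha_max k l - alpha_min k l))"

definition gap_param ::
    "nat \<Rightarrow> (real^'n \<Rightarrow> (real^'n) set measure) \<Rightarrow> (real^'n \<Rightarrow> real) \<Rightarrow> real" where
  "gap_param k \<nu> l =
     (INF x\<in>{x. x \<noteq> 0 \<and> \<not> plane_min l constant_on grassmannian_through k x}.
        L2_deviation (\<nu> x) (plane_min l) /
          ((SUP \<eta>\<in>grassmannian_through k x. plane_min l \<eta>) -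
           (INF \<eta>\<in>grassmannian_through k x. plane_min l \<eta>)))"

text \<open>
  Conditionally on the sigma-algebra \<open>G\<close>, the random \<open>k\<close>-planes \<open>\<zeta> 0, \<dots>, \<zeta> (T - 1)\<close> are
  independent, each with law \<open>\<kappa> \<omega>\<close>. The intersection with the space of \<open>\<kappa> \<omega>\<close> is there
  because \<open>\<kappa> \<omega>\<close> may live on a subset of the Grassmannian.
\<close>
definition sampled_iid ::
    "'w measure \<Rightarrow> 'w measure \<Rightarrow> nat \<Rightarrow> nat \<Rightarrow> ('w \<Rightarrow> (real^'n) set measure) \<Rightarrow>
     (nat \<Rightarrow> 'w \<Rightarrow> (real^'n) set) \<Rightarrow> bool" where
  "sampled_iid M G k T \<kappa> \<zeta> \<longleftrightarrow>
     (\<forall>H\<in>sets G. \<forall>A. (\<forall>j<T. A j \<in> sets (grassmannian_borel k)) \<longrightarrow>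
        emeasure M (H \<inter> {\<omega>\<in>space M. \<forall>j<T. \<zeta> j \<omega> \<in> A j}) =
        (\<integral>\<^sup>+\<omega>\<in>H. (\<Prod>j<T. emeasure (\<kappa> \<omega>) (A j \<inter> space (\<kappa> \<omega>))) \<partial>M))"

text \<open>
  A run of the random-subspace walk on a probability space \<open>M\<close>. The \<open>i\<close>-th batch of samples is
  \<open>\<eta> i 0, \<dots>, \<eta> i (T - 1)\<close> and produces \<open>x i\<close> (\<open>i \<ge> 1\<close>); \<open>F i\<close> is the information
  available once \<open>x i\<close> has been chosen. Ties in the choice of \<open>x i\<close> may be broken arbitrarily, as
  long as \<open>x i\<close> is a random variable. The loop body is repeated indefinitely here; the exit
  condition of the loop is read off a path by \<open>exit_index\<close> below.
\<close>
locale random_subspace_walk = prob_space M + filtration "space M" F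
  for M :: "'w measure" and F :: "nat \<Rightarrow> 'w measure" +
  fixes k T :: nat
    and l :: "real^'n \<Rightarrow> real"
    and B :: "(real^'n) set \<Rightarrow> real^'n"
    and \<mu> :: "(real^'n) set measure"
    and \<nu> :: "real^'n \<Rightarrow> (real^'n) set measure"
    and x0 :: "real^'n"
    and \<eta> :: "nat \<Rightarrow> nat \<Rightarrow> 'w \<Rightarrow> (real^'n) set"
    and x :: "nat \<Rightarrow> 'w \<Rightarrow> real^'n"
  assumes subalgebra_F: "\<And>i. subalgebra M (F i)"
    and measurable_x: "\<And>i. x i \<in> borel_measurable (F i)"
    and measurable_\<eta>: "\<And>i j. j < T \<Longrightarrow> \<eta> (Suc i) j \<in> measurable (F (Suc i)) (grassmannian_borel k)"
    and start: "\<And>\<omega>. \<omega> \<in> space M \<Longrightarrow> x 0 \<omega> = x0"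
    and first_batch: "sampled_iid M (F 0) k T (\<lambda>\<omega>. \<mu>) (\<eta> 1)"
    and next_batch: "\<And>i. i \<ge> 1 \<Longrightarrow> sampled_iid M (F i) k T (\<lambda>\<omega>. \<nu> (x i \<omega>)) (\<eta> (Suc i))"
    and choice: "\<And>i \<omega>. \<omega> \<in> space M \<Longrightarrow>
      is_arg_min l (\<lambda>y. y \<in> (\<lambda>j. B (\<eta> (Suc i) j \<omega>)) ` {..<T}) (x (Suc i) \<omega>)"

text \<open>
  The index \<open>i\<close> at which the loop is left along the path \<open>y\<close>, so that the algorithm returns
  \<open>y (exit_index l \<epsilon> y)\<close> after \<open>exit_index l \<epsilon> y - 1\<close> executions of the loop body.
\<close>
definition exit_index :: "(real^'n \<Rightarrow> real) \<Rightarrow> real \<Rightarrow> (nat \<Rightarrow> real^'n) \<Rightarrow> nat" where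
  "exit_index l \<epsilon> y = (LEAST i. i \<ge> 1 \<and> \<not> (l (y (i - 1)) - l (y i) > \<epsilon>))"

text \<open>The loop is always left, so the \<open>LEAST\<close> above is meaningful.\<close>
lemma exit_index_exists:
  fixes l :: "real^'n \<Rightarrow> real" and y :: "nat \<Rightarrow> real^'n"
  assumes "bdd_below (range l)" and "\<epsilon> > 0"
  shows "\<exists>i\<ge>1. \<not> (l (y (i - 1)) - l (y i) > \<epsilon>)"
proof (rule ccontr)
  assume "\<not> ?thesis"
  then have step: "l (y i) - l (y (Suc i)) > \<epsilon>" for i :: nat
    by (metis diff_Suc_1 le_add1 plus_1_eq_Suc)
  have dec: "l (y n) \<le> l (y 0) - real n * \<epsilon>" for n
  proof (induction n)
    case (Suc n)
    then show ?case using step[of n] by (simp add: algebra_simps)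
  qed simp
  obtain b where b: "\<And>z. b \<le> l z"
    using assms(1) by (auto simp: bdd_below_def)
  obtain n where "real n * \<epsilon> > l (y 0) - b"
    using reals_Archimedean3[OF assms(2)] by blast
  with dec[of n] b[of "y n"] show False by simp
qed

end

theory Submission
  imports Defs
begin

text \<open>
  Write \<open>\<phi>\<close> for the minimum of the loss on a plane. A bounded random variable with a large variance
  must lie substantially below its maximum with substantial probability: if its standard deviation
  is at least \<open>sqrt 2 t\<close> times its range, it loses the fraction \<open>t\<close> of the range with probability
  at least \<open>t\<^sup>2\<close> (\<open>prob_drop_below_max\<close>). For \<open>\<phi>\<close> on the whole Grassmannian this applies with
  \<open>t = \<delta>\<close>; for \<open>\<phi>\<close> on the planes through a point \<open>z \<noteq> 0\<close> it applies with \<open>t = \<Theta> / sqrt 2\<close>.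
  Planes through \<open>z\<close> still reach the global minimum because \<open>k \<ge> 2\<close>, and their \<open>\<phi>\<close> is at most
  \<open>l z\<close>, so such a drop contracts the excess loss \<open>l z - \<alpha>min\<close> by the factor
  \<open>1 - \<Theta> / sqrt 2\<close> (\<open>prob_good_gap\<close>). A batch of \<open>T\<close> independent planes contains a good one with
  probability at least \<open>1 - (1 - t\<^sup>2) ^ T\<close> (\<open>batch_succeeds\<close>), and multiplying these conditional
  probabilities along the walk gives the success probability (\<open>prob_below_geometric\<close>). That \<open>\<phi>\<close> is
  a random variable follows by writing \<open>\<phi> < a\<close> as the event that a plane hits an open set, and
  that event by countably many conditions on orthogonal projections.

  The gap parameter ignores the origin, where planes through the current point are just all planes.
  The walk avoids the origin on the success event: every plane contains \<open>0\<close>, so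
  \<open>\<alpha>max \<le> l 0\<close>, and a first step that succeeds with \<open>\<delta> > 0\<close> ends strictly below \<open>l 0\<close>, as do all
  later ones. If \<open>\<delta> = 0\<close> but \<open>\<phi>\<close> is not constant, the general lower bound on the probability is
  zero, but the statement about the prescribed sample size still has content; there \<open>\<phi>\<close> is almost
  surely a constant below \<open>l 0\<close>, which replaces the bound for the first step (\<open>degenerate_delta\<close>).
  If \<open>\<phi>\<close> is constant, every batch finds a global minimizer.

  On a successful run the \<open>n\<close>-th point has excess loss at most \<open>loss_bound (n - 1)\<close>, and no later
  point can improve by more than that. The prescribed number of iterations comes
  from solving \<open>loss_bound (n - 1) \<le> \<epsilon>\<close> for \<open>n\<close>, and the sample size from requiring that each of
  the two factors of the success probability be at least \<open>1 / sqrt 2\<close>.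
\<close>

section \<open>Variance forces values well below the maximum\<close>

text \<open>
  In terms of the depth \<open>g = m + R - f\<close> below the upper bound, the variance is at most the
  second moment of \<open>g\<close>. The event that \<open>g\<close> is at least \<open>t R\<close>, of probability \<open>P\<close>, contributes at
  most \<open>P R\<^sup>2\<close> to that moment and its complement at most \<open>(1 - P) t\<^sup>2 R\<^sup>2\<close>. A variance of at least
  \<open>2 t\<^sup>2 R\<^sup>2\<close> therefore leaves \<open>P \<ge> t\<^sup>2\<close>; this is where the factor \<open>1 / sqrt 2\<close> in the bounds comes
  from.
\<close>
lemma (in prob_space) prob_drop_below_max:
  fixes f :: "'a \<Rightarrow> real"
  assumes f [measurable]: "f \<in> borel_measurable M"
    and bounds: "\<And>\<omega>. \<omega> \<in> space M \<Longrightarrow> m \<le> f \<omega> \<and> f \<omega> \<le> m + R"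
    and "R > 0" and "t \<ge> 0" and dev: "sqrt 2 * t * R \<le> L2_deviation M f"
  shows "t\<^sup>2 \<le> prob {\<omega> \<in> space M. f \<omega> - m \<le> (1 - t) * R}"
proof -
  define g where "g = (\<lambda>\<omega>. m + R - f \<omega>)"
  define A where "A = {\<omega> \<in> space M. f \<omega> - m \<le> (1 - t) * R}"
  have g [measurable]: "g \<in> borel_measurable M" unfolding g_def by measurable
  have A [measurable]: "A \<in> sets M" unfolding A_def by measurable
  have int_f: "integrable M f"
    by (rule integrable_const_bound[of _ "\<bar>m\<bar> + \<bar>m + R\<bar>"]) (use bounds in \<open>fastforce+\<close>)
  have g_bounds: "0 \<le> g \<omega> \<and> g \<omega> \<le> R" if "\<omega> \<in> space M" for \<omega>
    using bounds[OF that] by (auto simp: g_def)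
  have int_g: "integrable M g" unfolding g_def using int_f by simp
  have int_g2: "integrable M (\<lambda>\<omega>. (g \<omega>)\<^sup>2)"
    by (rule integrable_const_bound[of _ "R\<^sup>2"]) (use g_bounds in \<open>auto intro!: AE_I2 power_mono\<close>)
  have Eg: "expectation g = m + R - expectation f"
    unfolding g_def using int_f by (simp add: prob_space)
  have "2 * t\<^sup>2 * R\<^sup>2 = (sqrt 2 * t * R)\<^sup>2" by (simp add: power_mult_distrib)
  also have "\<dots> \<le> (L2_deviation M f)\<^sup>2"
    using dev \<open>R > 0\<close> \<open>t \<ge> 0\<close> by (intro power_mono) auto
  also have "\<dots> = variance f"
    by (simp add: L2_deviation_def L2_norm_def)
  also have "\<dots> = variance g"
    unfolding Eg by (simp add: g_def power2_commute)
  also have "\<dots> \<le> expectation (\<lambda>\<omega>. (g \<omega>)\<^sup>2)"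
    using variance_eq[OF int_g int_g2] by simp
  also have "\<dots> \<le> expectation (\<lambda>\<omega>. t\<^sup>2 * R\<^sup>2 + (R\<^sup>2 - t\<^sup>2 * R\<^sup>2) * indicator A \<omega>)"
  proof (rule integral_mono)
    fix \<omega> assume \<omega>: "\<omega> \<in> space M"
    show "(g \<omega>)\<^sup>2 \<le> t\<^sup>2 * R\<^sup>2 + (R\<^sup>2 - t\<^sup>2 * R\<^sup>2) * indicator A \<omega>"
    proof (cases "\<omega> \<in> A")
      case True
      then show ?thesis using g_bounds[OF \<omega>] by (auto intro: power_mono)
    next
      case False
      then have "g \<omega> \<le> t * R" using \<omega> by (auto simp: A_def g_def algebra_simps)
      then have "(g \<omega>)\<^sup>2 \<le> (t * R)\<^sup>2" using g_bounds[OF \<omega>] by (intro power_mono) auto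
      then show ?thesis using False by (simp add: power_mult_distrib)
    qed
  qed (use int_g2 in \<open>auto simp: emeasure_eq_measure\<close>)
  also have "\<dots> = t\<^sup>2 * R\<^sup>2 + (R\<^sup>2 - t\<^sup>2 * R\<^sup>2) * prob A"
    by (subst Bochner_Integration.integral_add) (auto simp: prob_space emeasure_eq_measure)
  finally have "t\<^sup>2 * R\<^sup>2 \<le> (1 - t\<^sup>2) * prob A * R\<^sup>2" by (simp add: algebra_simps)
  then have "t\<^sup>2 \<le> (1 - t\<^sup>2) * prob A" using \<open>R > 0\<close> by simp
  also have "\<dots> \<le> prob A" using mult_nonneg_nonneg[of "t\<^sup>2" "prob A"] by (simp add: algebra_simps)
  finally show ?thesis unfolding A_def .
qed

lemma (in prob_space) square_dist_mean_le_range: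
  fixes f :: "'a \<Rightarrow> real"
  assumes f [measurable]: "f \<in> borel_measurable M"
    and bounds: "\<And>\<omega>. \<omega> \<in> space M \<Longrightarrow> m \<le> f \<omega> \<and> f \<omega> \<le> m + R"
  shows "\<omega> \<in> space M \<Longrightarrow> (f \<omega> - expectation f)\<^sup>2 \<le> R\<^sup>2"
    and "integrable M (\<lambda>\<omega>. (f \<omega> - expectation f)\<^sup>2)"
proof -
  have int_f: "integrable M f"
    by (rule integrable_const_bound[of _ "\<bar>m\<bar> + \<bar>m + R\<bar>"]) (use bounds in \<open>fastforce+\<close>)
  have R: "R \<ge> 0" using bounds not_empty by fastforce
  have Ef: "m \<le> expectation f" "expectation f \<le> m + R"
    using int_f bounds by (auto intro!: integral_ge_const integral_le_const AE_I2)
  have dist_mean: "(f \<omega> - expectation f)\<^sup>2 \<le> R\<^sup>2" if "\<omega> \<in> space M" for \<omega>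
  proof -
    have "\<bar>f \<omega> - expectation f\<bar> \<le> R" using bounds[OF that] Ef by linarith
    then show ?thesis using R by (metis abs_ge_zero power2_abs power_mono)
  qed
  show "\<omega> \<in> space M \<Longrightarrow> (f \<omega> - expectation f)\<^sup>2 \<le> R\<^sup>2" by (rule dist_mean)
  show "integrable M (\<lambda>\<omega>. (f \<omega> - expectation f)\<^sup>2)"
    by (rule integrable_const_bound[of _ "R\<^sup>2"]) (use dist_mean in \<open>auto intro!: AE_I2\<close>)
qed

lemma (in prob_space) L2_deviation_le_range:
  fixes f :: "'a \<Rightarrow> real"
  assumes f: "f \<in> borel_measurable M"
    and bounds: "\<And>\<omega>. \<omega> \<in> space M \<Longrightarrow> m \<le> f \<omega> \<and> f \<omega> \<le> m + R"
  shows "L2_deviation M f \<le> R"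
proof -
  have "R \<ge> 0" using bounds not_empty by fastforce
  moreover have "expectation (\<lambda>\<omega>. (f \<omega> - expectation f)\<^sup>2) \<le> R\<^sup>2"
    using square_dist_mean_le_range[OF f bounds] by (intro integral_le_const AE_I2) auto
  ultimately show ?thesis
    unfolding L2_deviation_def L2_norm_def by (intro real_le_lsqrt) auto
qed

lemma (in prob_space) AE_eq_mean_if_L2_deviation_zero:
  fixes f :: "'a \<Rightarrow> real"
  assumes f: "f \<in> borel_measurable M"
    and bounds: "\<And>\<omega>. \<omega> \<in> space M \<Longrightarrow> m \<le> f \<omega> \<and> f \<omega> \<le> m + R"
    and dev: "L2_deviation M f = 0"
  shows "AE \<omega> in M. f \<omega> = expectation f"
proof -
  have "expectation (\<lambda>\<omega>. (f \<omega> - expectation f)\<^sup>2) = 0"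
    using dev by (simp add: L2_deviation_def L2_norm_def)
  then show ?thesis
    using square_dist_mean_le_range(2)[OF f bounds] by (subst (asm) integral_nonneg_eq_0_iff_AE) auto
qed

section \<open>The Grassmannian\<close>

text \<open>
  The Borel structure on the Grassmannian is given by matrices of projections; linearity is what
  allows a projected point to be recovered from such a matrix.
\<close>
lemma linear_closest_point:
  fixes \<eta> :: "(real^'n) set"
  assumes "subspace \<eta>"
  shows "linear (closest_point \<eta>)"
proof -
  have closed: "closed \<eta>" and ne: "\<eta> \<noteq> {}"
    using assms closed_subspace subspace_0 by auto
  have proj: "closest_point \<eta> a = p" if "p \<in> \<eta>" and orth: "\<And>z. z \<in> \<eta> \<Longrightarrow> (a - p) \<bullet> z = 0" for a p
  proof -
    have "dist a p \<le> dist a z" if "z \<in> \<eta>" for z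
    proof -
      have "(a - p) \<bullet> (p - z) = 0" using orth[of "p - z"] that \<open>p \<in> \<eta>\<close> assms by (simp add: subspace_diff)
      then have "(norm (a - z))\<^sup>2 = (norm (a - p))\<^sup>2 + (norm (p - z))\<^sup>2"
        using norm_add_Pythagorean[of "a - p" "p - z"] by (simp add: orthogonal_def)
      then show ?thesis unfolding dist_norm by (simp add: power2_le_imp_le)
    qed
    then show ?thesis
      using closest_point_unique[OF subspace_imp_convex[OF assms] closed \<open>p \<in> \<eta>\<close>] by auto
  qed
  have orth: "(a - closest_point \<eta> a) \<bullet> z = 0" if "z \<in> \<eta>" for a z
  proof -
    let ?p = "closest_point \<eta> a"
    have p: "?p \<in> \<eta>" using closest_point_in_set[OF closed ne] .
    have "(a - ?p) \<bullet> w \<le> 0" if "w \<in> \<eta>" for w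
      using closest_point_dot[OF subspace_imp_convex[OF assms] closed, of "?p + w" a]
        subspace_add[OF assms p that] by simp
    from this[OF that] this[OF subspace_neg[OF assms that]] show ?thesis by simp
  qed
  have mem: "closest_point \<eta> a \<in> \<eta>" for a using closest_point_in_set[OF closed ne] .
  show ?thesis
  proof (rule linearI)
    fix a b :: "real^'n" and c :: real
    show "closest_point \<eta> (a + b) = closest_point \<eta> a + closest_point \<eta> b"
      by (rule proj) (use orth[of _ a] orth[of _ b] in
        \<open>auto simp: assms mem subspace_add inner_diff_left inner_add_left\<close>)
    show "closest_point \<eta> (c *\<^sub>R a) = c *\<^sub>R closest_point \<eta> a"
      by (rule proj) (use orth[of _ a] in \<open>auto simp: assms mem subspace_scale inner_diff_left\<close>)
  qed
qed

lemma space_grassmannian_borel [simp]: "space (grassmannian_borel k) = grassmannian k"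
  by (simp add: grassmannian_borel_def)

lemma measurable_projection_of_point:
  fixes y :: "real^'n"
  shows "(\<lambda>\<eta>. closest_point \<eta> y) \<in> borel_measurable (grassmannian_borel k)"
proof -
  have "continuous_on UNIV (\<lambda>A :: real^'n^'n. A *v y)"
    unfolding matrix_vector_mult_def by (intro continuous_intros continuous_on_vec_lambda)
  then have "(\<lambda>A :: real^'n^'n. A *v y) \<in> borel_measurable borel"
    by (rule borel_measurable_continuous_onI)
  moreover have "(\<lambda>\<eta>. matrix (closest_point \<eta>)) \<in> borel_measurable (grassmannian_borel k)"
    unfolding grassmannian_borel_def by (rule measurable_vimage_algebra1) simp
  ultimately have "(\<lambda>\<eta>. matrix (closest_point \<eta>) *v y) \<in> borel_measurable (grassmannian_borel k)"
    by (rule measurable_compose[rotated])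
  then show ?thesis
    by (subst measurable_cong[of _ _ "\<lambda>\<eta>. matrix (closest_point \<eta>) *v y"])
      (simp_all add: grassmannian_def linear_closest_point matrix_works)
qed

text \<open>
  Projection onto \<open>\<eta>\<close> maps the whole space onto \<open>\<eta>\<close> continuously, so \<open>\<eta>\<close> meets the open set \<open>U\<close> iff
  the projection of some point of a fixed countable dense set lies in \<open>U\<close>. The event is thus a
  countable union of events about projections of single points.
\<close>
lemma planes_hitting_open_measurable:
  fixes U :: "(real^'n) set"
  assumes "open U"
  shows "{\<eta> \<in> grassmannian k. \<eta> \<inter> U \<noteq> {}} \<in> sets (grassmannian_borel k)"
proof -
  obtain D :: "(real^'n) set" where "countable D"
    and dense: "\<And>V. open V \<Longrightarrow> V \<noteq> {} \<Longrightarrow> \<exists>d\<in>D. d \<in> V"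
    by (rule countable_dense_setE) blast
  have "{\<eta> \<in> grassmannian k. \<eta> \<inter> U \<noteq> {}} =
      (\<Union>d\<in>D. {\<eta> \<in> grassmannian k. closest_point \<eta> d \<in> U})" (is "?L = ?R")
  proof (intro equalityI subsetI)
    fix \<eta> assume "\<eta> \<in> ?L"
    then obtain y where \<eta>: "\<eta> \<in> grassmannian k" and y: "y \<in> \<eta>" "y \<in> U" by auto
    have sub: "subspace \<eta>" using \<eta> by (simp add: grassmannian_def)
    have "continuous_on UNIV (closest_point \<eta>)"
      using linear_closest_point[OF sub] linear_continuous_on linear_conv_bounded_linear by blast
    then have "open (closest_point \<eta> -` U)" using assms by (simp add: open_vimage)
    moreover have "y \<in> closest_point \<eta> -` U" using y by (simp add: closest_point_self)
    ultimately show "\<eta> \<in> ?R" using dense[of "closest_point \<eta> -` U"] \<eta> by auto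
  next
    fix \<eta> assume "\<eta> \<in> ?R"
    then obtain d where \<eta>: "\<eta> \<in> grassmannian k" and d: "closest_point \<eta> d \<in> U" by auto
    have "subspace \<eta>" using \<eta> by (simp add: grassmannian_def)
    then have "closest_point \<eta> d \<in> \<eta>"
      using closed_subspace closest_point_in_set subspace_0 by (metis empty_iff)
    then show "\<eta> \<in> ?L" using \<eta> d by auto
  qed
  moreover have "{\<eta> \<in> grassmannian k. closest_point \<eta> d \<in> U} \<in> sets (grassmannian_borel k)" for d
    using measurable_sets[OF measurable_projection_of_point, of U d k] assms
    by (simp add: vimage_def Int_def conj_commute)
  ultimately show ?thesis using \<open>countable D\<close> by auto
qed

lemma subspace_extension:
  fixes S :: "(real^'n) set"
  assumes "subspace S" and "dim S \<le> k" and "k \<le> CARD('n)"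
  obtains \<eta> where "\<eta> \<in> grassmannian k" and "S \<subseteq> \<eta>"
proof -
  have "\<exists>\<eta>\<in>grassmannian k. S \<subseteq> \<eta>"
    using assms(2,3)
  proof (induction k rule: dec_induct)
    case base
    then show ?case using assms(1) by (auto simp: grassmannian_def)
  next
    case (step m)
    then obtain \<eta> where \<eta>: "subspace \<eta>" "dim \<eta> = m" "S \<subseteq> \<eta>"
      by (auto simp: grassmannian_def)
    have "\<eta> \<noteq> UNIV" using \<eta>(2) step.prems by auto
    then obtain a where "a \<notin> \<eta>" by auto
    then have "dim (span (insert a \<eta>)) = Suc m"
      using \<eta> by (simp add: dim_insert span_eq_iff[THEN iffD2])
    then have "span (insert a \<eta>) \<in> grassmannian (Suc m)" by (simp add: grassmannian_def)
    moreover have "S \<subseteq> span (insert a \<eta>)"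
      using \<eta>(3) span_superset[of "insert a \<eta>"] by auto
    ultimately show ?case by blast
  qed
  then show ?thesis using that by blast
qed

lemma plane_through_two_points:
  fixes y z :: "real^'n"
  assumes "2 \<le> k" and "k \<le> CARD('n)"
  obtains \<eta> where "\<eta> \<in> grassmannian k" and "y \<in> \<eta>" and "z \<in> \<eta>"
proof -
  have "dim (span {y, z}) \<le> card {y, z}" by (simp add: dim_le_card')
  also have "\<dots> \<le> 2" by (simp add: card_insert_if)
  finally obtain \<eta> where "\<eta> \<in> grassmannian k" "span {y, z} \<subseteq> \<eta>"
    using subspace_extension[of "span {y, z}" k] assms by auto
  then show ?thesis using that span_superset[of "{y, z}"] by auto
qed

lemma invariant_prob_facts:
  assumes inv: "invariant_prob k X G N" and "X \<subseteq> grassmannian k"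
  shows "prob_space N" and "space N = X"
    and "A \<in> sets (grassmannian_borel k) \<Longrightarrow> A \<inter> X \<in> sets N"
    and "f \<in> borel_measurable (grassmannian_borel k) \<Longrightarrow> f \<in> borel_measurable N"
proof -
  have sets: "sets N = sets (restrict_space (grassmannian_borel k) X)"
    using inv by (simp add: invariant_prob_def)
  show "prob_space N" using inv by (simp add: invariant_prob_def)
  show "space N = X"
    using sets_eq_imp_space_eq[OF sets] \<open>X \<subseteq> grassmannian k\<close> by (auto simp: space_restrict_space)
  show "A \<inter> X \<in> sets N" if "A \<in> sets (grassmannian_borel k)"
    using that unfolding sets by (auto simp: sets_restrict_space)
  show "f \<in> borel_measurable N" if "f \<in> borel_measurable (grassmannian_borel k)" for f :: "_ \<Rightarrow> 'b::topological_space"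
    using measurable_restrict_space1[OF that] measurable_cong_sets[OF sets refl] by blast
qed

text \<open>
  A push-forward whose preimage formula fails to define a measure is the null measure. The
  push-forward by \<open>f\<close> equals the probability measure \<open>\<mu>\<close>, which is not null, so the preimage
  formula must hold.
\<close>
lemma invariant_prob_emeasure_vimage:
  assumes inv: "invariant_prob k X G \<mu>" and "f \<in> G" and "A \<in> sets \<mu>"
  shows "emeasure \<mu> {\<eta> \<in> space \<mu>. f ` \<eta> \<in> A} = emeasure \<mu> A"
proof -
  interpret prob_space \<mu> using inv by (simp add: invariant_prob_def)
  have eq: "distr \<mu> \<mu> (\<lambda>\<eta>. f ` \<eta>) = \<mu>" using inv \<open>f \<in> G\<close> by (simp add: invariant_prob_def)
  let ?P = "measure_space (space \<mu>) (sigma_sets (space \<mu>) (sets \<mu>))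
      (\<lambda>A. emeasure \<mu> ((\<lambda>\<eta>. f ` \<eta>) -` A \<inter> space \<mu>))"
  have conv: "emeasure \<mu> C = (if ?P then emeasure \<mu> ((\<lambda>\<eta>. f ` \<eta>) -` C \<inter> space \<mu>) else 0)"
    if "C \<in> sets \<mu>" for C
  proof -
    have "emeasure \<mu> C = emeasure (distr \<mu> \<mu> (\<lambda>\<eta>. f ` \<eta>)) C" by (simp add: eq)
    also have "\<dots> = (if ?P then emeasure \<mu> ((\<lambda>\<eta>. f ` \<eta>) -` C \<inter> space \<mu>) else 0)"
      unfolding distr_def emeasure_measure_of_conv using that by (simp add: sets.sigma_sets_eq)
    finally show ?thesis .
  qed
  have ?P using conv[OF sets.top] emeasure_space_1 by (auto split: if_splits)
  then show ?thesis using conv[OF \<open>A \<in> sets \<mu>\<close>]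
    by (simp add: vimage_def Int_def conj_commute)
qed

text \<open>
  Fix \<open>y \<in> U\<close>. Finitely many rotated copies of \<open>U\<close> cover the compact sphere of radius \<open>norm y\<close>, and
  every plane meets that sphere, hence one of the copies. By invariance all copies are hit with
  the same probability, which therefore cannot vanish.
\<close>
lemma uniform_hits_open_positive:
  fixes U :: "(real^'n) set"
  assumes unif: "uniform_grassmannian k \<mu>" and "1 \<le> k" and "open U" and "U \<noteq> {}"
  shows "emeasure \<mu> {\<eta> \<in> grassmannian k. \<eta> \<inter> U \<noteq> {}} > 0"
proof -
  have inv: "invariant_prob k (grassmannian k) {f. orthogonal_transformation f} \<mu>"
    using unif by (simp add: uniform_grassmannian_def)
  then interpret prob_space \<mu> by (simp add: invariant_prob_def)
  have "sets \<mu> = sets (restrict_space (grassmannian_borel k) (grassmannian k))"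
    using inv by (simp add: invariant_prob_def)
  then have sets: "sets \<mu> = sets (grassmannian_borel k)"
    using sets.Int_space_eq1[of _ "grassmannian_borel k"] by (force simp: sets_restrict_space)
  then have space: "space \<mu> = grassmannian k"
    using sets_eq_imp_space_eq[OF sets] by simp
  define V where "V W = {\<eta> \<in> grassmannian k. \<eta> \<inter> W \<noteq> {}}" for W :: "(real^'n) set"
  obtain y where "y \<in> U" using assms(4) by auto
  define C where "C = (\<lambda>f. f -` U) ` {f :: real^'n \<Rightarrow> real^'n. orthogonal_transformation f}"
  have C_open: "open W" if "W \<in> C" for W
    using that \<open>open U\<close> unfolding C_def
    by (auto intro!: open_vimage linear_continuous_on simp: orthogonal_transformation_def linear_conv_bounded_linear)
  have "sphere 0 (norm y) \<subseteq> \<Union>C"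
  proof
    fix z :: "real^'n" assume "z \<in> sphere 0 (norm y)"
    then have "norm z = norm y" by simp
    then obtain f where "orthogonal_transformation f" "f z = y"
      using orthogonal_transformation_exists by blast
    then show "z \<in> \<Union>C" using \<open>y \<in> U\<close> by (auto simp: C_def)
  qed
  then obtain D where D: "D \<subseteq> C" "finite D" "sphere 0 (norm y) \<subseteq> \<Union>D"
    using compactE[of "sphere 0 (norm y)" C] C_open by (metis compact_sphere)
  have "V W \<in> sets \<mu>" if "open W" for W
    using planes_hitting_open_measurable[OF that] sets by (simp add: V_def)
  note V_sets = this
  have V_eq: "emeasure \<mu> (V W) = emeasure \<mu> (V U)" if W: "W \<in> C" for W
  proof -
    obtain f where f: "orthogonal_transformation f" "W = f -` U"
      using W unfolding C_def by blast
    have "f ` \<eta> \<in> grassmannian k" if "\<eta> \<in> grassmannian k" for \<eta>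
    proof -
      have "linear f" "inj f"
        using f(1) by (simp_all add: orthogonal_transformation_linear orthogonal_transformation_inj)
      then have "dim (f ` \<eta>) = dim \<eta>" "subspace (f ` \<eta>)" if "subspace \<eta>"
        using that by (simp_all add: dim_image_eq inj_on_subset linear_subspace_image)
      then show ?thesis using that by (simp add: grassmannian_def)
    qed
    then have "V W = {\<eta> \<in> space \<mu>. f ` \<eta> \<in> V U}"
      unfolding V_def f(2) space by auto
    then show ?thesis
      using invariant_prob_emeasure_vimage[OF inv, of f "V U"] f(1) V_sets[OF \<open>open U\<close>] by simp
  qed
  have "grassmannian k \<subseteq> (\<Union>W\<in>D. V W)"
  proof
    fix \<eta> :: "(real^'n) set" assume \<eta>: "\<eta> \<in> grassmannian k"
    then have "subspace \<eta>" "dim \<eta> \<noteq> 0" using \<open>1 \<le> k\<close> by (auto simp: grassmannian_def)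
    then obtain w where w: "w \<in> \<eta>" "w \<noteq> 0" by (auto simp: dim_eq_0)
    let ?w = "(norm y / norm w) *\<^sub>R w"
    have "?w \<in> \<eta>" using w \<open>subspace \<eta>\<close> by (simp add: subspace_scale)
    have "?w \<in> sphere 0 (norm y)" using w by simp
    then obtain W where "W \<in> D" "?w \<in> W" using D(3) by blast
    with \<open>?w \<in> \<eta>\<close> \<eta> show "\<eta> \<in> (\<Union>W\<in>D. V W)" unfolding V_def by blast
  qed
  moreover have "(\<Union>W\<in>D. V W) \<subseteq> grassmannian k" by (auto simp: V_def)
  ultimately have "(\<Union>W\<in>D. V W) = space \<mu>" by (simp add: space)
  then have "1 = emeasure \<mu> (\<Union>W\<in>D. V W)" by (simp add: emeasure_space_1)
  also have "\<dots> \<le> (\<Sum>W\<in>D. emeasure \<mu> (V W))"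
    using D C_open V_sets by (intro emeasure_subadditive_finite) auto
  also have "\<dots> = (\<Sum>W\<in>D. emeasure \<mu> (V U))" using D(1) V_eq by (intro sum.cong) auto
  finally have "1 \<le> of_nat (card D) * emeasure \<mu> (V U)" by simp
  then have "emeasure \<mu> (V U) \<noteq> 0" by fastforce
  then show ?thesis unfolding V_def by (simp add: zero_less_iff_neq_zero)
qed

section \<open>Minima of a coercive loss over planes\<close>

locale coercive_loss =
  fixes l :: "real^'n \<Rightarrow> real" and k :: nat
  assumes k: "1 < k" "k < CARD('n)"
    and cont: "continuous_on UNIV l" and coercive: "coercive l"
begin

abbreviation \<phi> :: "(real^'n) set \<Rightarrow> real" where "\<phi> \<equiv> plane_min l"
abbreviation \<alpha>min :: real where "\<alpha>min \<equiv> alpha_min k l"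
abbreviation \<alpha>max :: real where "\<alpha>max \<equiv> alpha_max k l"

lemma attains_min_on_closed:
  assumes "closed S" and "S \<noteq> {}"
  obtains y where "y \<in> S" and "\<And>z. z \<in> S \<Longrightarrow> l y \<le> l z"
proof -
  obtain a where a: "a \<in> S" using assms(2) by auto
  have "eventually (\<lambda>z. l a \<le> l z) at_infinity"
    using coercive by (simp add: coercive_def filterlim_at_top)
  then obtain b where b: "\<And>z. b \<le> norm z \<Longrightarrow> l a \<le> l z"
    by (auto simp: eventually_at_infinity)
  let ?K = "S \<inter> cball 0 (max b (norm a))"
  have "compact ?K" using assms(1) by (simp add: closed_Int_compact)
  moreover have "?K \<noteq> {}" using a by auto
  moreover have "continuous_on ?K l" using cont continuous_on_subset by blast
  ultimately obtain y where y: "y \<in> ?K" "\<And>z. z \<in> ?K \<Longrightarrow> l y \<le> l z"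
    using continuous_attains_inf[of ?K l] by metis
  have "l y \<le> l z" if "z \<in> S" for z
  proof (cases "z \<in> ?K")
    case False
    then have "l a \<le> l z" using that by (intro b) auto
    moreover have "l y \<le> l a" using a by (intro y(2)) auto
    ultimately show ?thesis by simp
  qed (rule y(2))
  then show ?thesis using that y(1) by auto
qed

lemma plane_min_attained:
  assumes "\<eta> \<in> grassmannian k"
  obtains y where "y \<in> \<eta>" and "\<phi> \<eta> = l y"
proof -
  have "closed \<eta>" "\<eta> \<noteq> {}"
    using assms closed_subspace subspace_0 by (auto simp: grassmannian_def)
  then obtain y where "y \<in> \<eta>" "\<And>z. z \<in> \<eta> \<Longrightarrow> l y \<le> l z"
    by (rule attains_min_on_closed) blast
  then show ?thesis
    using that[of y] by (auto simp: plane_min_def intro!: cInf_eq_minimum)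
qed

lemma bdd_below_l: "bdd_below (l ` S)"
proof -
  obtain y where "\<And>z. l y \<le> l z" by (rule attains_min_on_closed[of UNIV]) auto
  then show ?thesis by (auto intro!: bdd_belowI[of _ "l y"])
qed

lemma plane_min_le: "z \<in> \<eta> \<Longrightarrow> \<phi> \<eta> \<le> l z"
  unfolding plane_min_def by (intro cINF_lower bdd_below_l)

lemma zero_in_plane: "\<eta> \<in> grassmannian k \<Longrightarrow> 0 \<in> \<eta>"
  by (simp add: grassmannian_def subspace_0)

lemma alpha_min_attained:
  obtains y where "l y = \<alpha>min" and "\<And>z. \<alpha>min \<le> l z"
proof -
  obtain y where y: "\<And>z. l y \<le> l z" by (rule attains_min_on_closed[of UNIV]) auto
  obtain \<zeta> :: "(real^'n) set" where \<zeta>: "\<zeta> \<in> grassmannian k" "y \<in> \<zeta>"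
    using plane_through_two_points[of k y y] k by auto
  have lower: "l y \<le> \<phi> \<eta>" if "\<eta> \<in> grassmannian k" for \<eta>
    using plane_min_attained[OF that] y by metis
  then have "\<phi> \<zeta> = l y" using plane_min_le[OF \<zeta>(2)] lower[OF \<zeta>(1)] by simp
  then have "\<alpha>min = l y"
    unfolding alpha_min_def using \<zeta>(1) lower by (intro cInf_eq_minimum) force+
  then show ?thesis using that[of y] y by simp
qed

lemma alpha_min_le: "\<alpha>min \<le> l z"
  using alpha_min_attained by metis

lemma alpha_min_le_plane_min: "\<eta> \<in> grassmannian k \<Longrightarrow> \<alpha>min \<le> \<phi> \<eta>"
  using plane_min_attained alpha_min_le by metis

lemma plane_min_le_alpha_max:
  assumes "\<eta> \<in> grassmannian k"
  shows "\<phi> \<eta> \<le> \<alpha>max"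
  unfolding alpha_max_def using assms plane_min_le[OF zero_in_plane]
  by (intro cSUP_upper bdd_aboveI2) auto

lemma alpha_max_le_origin: "\<alpha>max \<le> l 0"
proof -
  obtain \<zeta> :: "(real^'n) set" where "\<zeta> \<in> grassmannian k"
    using plane_through_two_points[of k "0 :: real^'n" 0] k by auto
  then show ?thesis
    unfolding alpha_max_def by (intro cSUP_least) (auto intro: plane_min_le zero_in_plane)
qed

lemma plane_through_point_and_minimizer:
  obtains \<zeta> where "\<zeta> \<in> grassmannian_through k z" and "\<phi> \<zeta> = \<alpha>min"
proof -
  obtain y where y: "l y = \<alpha>min" using alpha_min_attained by blast
  obtain \<zeta> where \<zeta>: "\<zeta> \<in> grassmannian k" "y \<in> \<zeta>" "z \<in> \<zeta>"
    using plane_through_two_points[of k y z] k by auto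
  have "\<phi> \<zeta> = \<alpha>min"
    using plane_min_le[OF \<zeta>(2)] y alpha_min_le_plane_min[OF \<zeta>(1)] by simp
  then show ?thesis using that[of \<zeta>] \<zeta> by (simp add: grassmannian_through_def)
qed

text \<open>
  Since \<open>k \<ge> 2\<close>, some \<open>k\<close>-plane contains both \<open>z\<close> and a global minimizer: restricting to planes
  through \<open>z\<close> does not raise the least attainable loss.
\<close>
lemma INF_plane_min_through: "(INF \<eta>\<in>grassmannian_through k z. \<phi> \<eta>) = \<alpha>min"
proof (rule cInf_eq_minimum)
  show "\<alpha>min \<in> \<phi> ` grassmannian_through k z"
    using plane_through_point_and_minimizer[of z] by (metis image_eqI)
qed (auto simp: grassmannian_through_def alpha_min_le_plane_min)

lemma SUP_plane_min_through:
  shows "(SUP \<eta>\<in>grassmannian_through k z. \<phi> \<eta>) \<le> l z"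
    and "\<eta> \<in> grassmannian_through k z \<Longrightarrow> \<phi> \<eta> \<le> (SUP \<eta>\<in>grassmannian_through k z. \<phi> \<eta>)"
proof -
  have le: "\<phi> \<eta> \<le> l z" if "\<eta> \<in> grassmannian_through k z" for \<eta>
    using that by (auto simp: grassmannian_through_def intro: plane_min_le)
  obtain \<zeta> where "\<zeta> \<in> grassmannian_through k z"
    by (rule plane_through_point_and_minimizer[of z])
  then show "(SUP \<eta>\<in>grassmannian_through k z. \<phi> \<eta>) \<le> l z"
    using le by (intro cSUP_least) auto
  show "\<phi> \<eta> \<le> (SUP \<eta>\<in>grassmannian_through k z. \<phi> \<eta>)" if "\<eta> \<in> grassmannian_through k z"
    using that le by (intro cSUP_upper bdd_aboveI2) auto
qed

lemma plane_min_less_iff: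
  assumes "\<eta> \<in> grassmannian k"
  shows "\<phi> \<eta> < a \<longleftrightarrow> \<eta> \<inter> {z. l z < a} \<noteq> {}"
proof
  assume "\<phi> \<eta> < a"
  moreover obtain y where "y \<in> \<eta>" "\<phi> \<eta> = l y" using assms by (rule plane_min_attained)
  ultimately show "\<eta> \<inter> {z. l z < a} \<noteq> {}" by auto
next
  assume "\<eta> \<inter> {z. l z < a} \<noteq> {}"
  then obtain z where "z \<in> \<eta>" "l z < a" by auto
  then show "\<phi> \<eta> < a" using plane_min_le[of z \<eta>] by simp
qed

lemma open_sublevel: "open {z. l z < a}"
  using cont by (simp add: open_Collect_less)

lemma plane_min_measurable: "\<phi> \<in> borel_measurable (grassmannian_borel k)"
proof (rule borel_measurable_iff_less[THEN iffD2, rule_format])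
  fix a
  have "{\<eta> \<in> space (grassmannian_borel k). \<phi> \<eta> < a} = {\<eta> \<in> grassmannian k. \<eta> \<inter> {z. l z < a} \<noteq> {}}"
    using plane_min_less_iff by (auto simp del: disjoint_iff)
  then show "{\<eta> \<in> space (grassmannian_borel k). \<phi> \<eta> < a} \<in> sets (grassmannian_borel k)"
    using planes_hitting_open_measurable[OF open_sublevel] by simp
qed

lemma loss_measurable: "l \<in> borel_measurable borel"
  using cont by (rule borel_measurable_continuous_onI)

definition good_planes :: "real \<Rightarrow> (real^'n) set set" where
  "good_planes c = {\<eta> \<in> grassmannian k. \<phi> \<eta> - \<alpha>min \<le> c}"

lemma good_planes_measurable: "good_planes c \<in> sets (grassmannian_borel k)"
proof -
  have "{\<eta> \<in> space (grassmannian_borel k). \<phi> \<eta> - \<alpha>min \<le> c} \<in> sets (grassmannian_borel k)"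
    using plane_min_measurable by measurable
  then show ?thesis by (simp add: good_planes_def)
qed

subsection \<open>The first sample\<close>

context
  fixes \<mu> :: "(real^'n) set measure"
  assumes unif: "uniform_grassmannian k \<mu>"
begin

lemma uniform_facts: "prob_space \<mu>" "space \<mu> = grassmannian k" "\<phi> \<in> borel_measurable \<mu>"
  using unif invariant_prob_facts[of k "grassmannian k" _ \<mu>] plane_min_measurable
  by (auto simp: uniform_grassmannian_def)

lemma delta_param_nonneg:
  assumes "\<alpha>min < \<alpha>max"
  shows "0 \<le> delta_param k \<mu> l"
  using assms by (simp add: delta_param_def L2_deviation_def L2_norm_def)

lemma delta_param_less_1:
  assumes "\<alpha>min < \<alpha>max"
  shows "delta_param k \<mu> l < 1"
proof -
  interpret prob_space \<mu> by (rule uniform_facts)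
  have "L2_deviation \<mu> \<phi> \<le> \<alpha>max - \<alpha>min"
    by (rule L2_deviation_le_range[OF uniform_facts(3), of "\<alpha>min"])
      (auto simp: uniform_facts alpha_min_le_plane_min plane_min_le_alpha_max)
  then have "L2_deviation \<mu> \<phi> / (\<alpha>max - \<alpha>min) \<le> 1" using assms by simp
  moreover have "1 / sqrt 2 < (1::real)" by simp
  ultimately show ?thesis unfolding delta_param_def
    by (smt (verit) mult_left_le real_sqrt_gt_zero zero_less_divide_1_iff)
qed

lemma prob_good_delta:
  assumes "\<alpha>min < \<alpha>max"
  defines "\<delta> \<equiv> delta_param k \<mu> l"
  shows "\<delta>\<^sup>2 \<le> measure \<mu> (good_planes ((1 - \<delta>) * (\<alpha>max - \<alpha>min)))"
proof -
  interpret prob_space \<mu> by (rule uniform_facts)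
  have "sqrt 2 * \<delta> * (\<alpha>max - \<alpha>min) = L2_deviation \<mu> \<phi>"
    using assms(1) by (simp add: \<delta>_def delta_param_def)
  then have "\<delta>\<^sup>2 \<le> prob {\<eta> \<in> space \<mu>. \<phi> \<eta> - \<alpha>min \<le> (1 - \<delta>) * (\<alpha>max - \<alpha>min)}"
    using assms delta_param_nonneg
    by (intro prob_drop_below_max uniform_facts)
      (auto simp: uniform_facts alpha_min_le_plane_min plane_min_le_alpha_max)
  then show ?thesis by (simp add: good_planes_def uniform_facts)
qed

text \<open>
  When \<open>\<delta> = 0\<close>, the plane minimum is almost surely a constant, which lies strictly below the loss
  at the origin because planes hit the nonempty open set of points better than the origin with
  positive probability. This keeps the walk away from the origin even when \<open>\<delta>\<close> gives no
  information.
\<close>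
lemma degenerate_delta:
  assumes "\<alpha>min < \<alpha>max" and "delta_param k \<mu> l = 0"
  obtains c where "0 \<le> c" and "c \<le> \<alpha>max - \<alpha>min" and "c < l 0 - \<alpha>min"
    and "measure \<mu> (good_planes c) = 1"
proof -
  interpret prob_space \<mu> by (rule uniform_facts)
  have bounds: "\<alpha>min \<le> \<phi> \<eta> \<and> \<phi> \<eta> \<le> \<alpha>min + (\<alpha>max - \<alpha>min)" if "\<eta> \<in> space \<mu>" for \<eta>
    using that by (simp add: uniform_facts alpha_min_le_plane_min plane_min_le_alpha_max)
  have "L2_deviation \<mu> \<phi> = 0" using assms by (simp add: delta_param_def)
  then have ae: "AE \<eta> in \<mu>. \<phi> \<eta> = expectation \<phi>"
    using AE_eq_mean_if_L2_deviation_zero[OF uniform_facts(3) bounds] by blast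
  define a where "a = expectation \<phi>"
  obtain y where y: "l y = \<alpha>min" using alpha_min_attained by blast
  have "emeasure \<mu> {\<eta> \<in> grassmannian k. \<eta> \<inter> {z. l z < l 0} \<noteq> {}} > 0"
  proof (rule uniform_hits_open_positive[OF unif _ open_sublevel])
    have "l y < l 0" using y assms(1) alpha_max_le_origin by simp
    then show "{z. l z < l 0} \<noteq> {}" by auto
  qed (use k in simp)
  then have pos: "emeasure \<mu> {\<eta> \<in> space \<mu>. \<phi> \<eta> < l 0} > 0"
    using plane_min_less_iff by (simp add: uniform_facts cong: conj_cong)
  have "\<exists>\<eta>\<in>space \<mu>. \<phi> \<eta> = a \<and> \<phi> \<eta> < l 0"
  proof (rule ccontr)
    assume none: "\<not> ?thesis"
    have "AE \<eta> in \<mu>. \<not> \<phi> \<eta> < l 0"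
      using ae AE_space by eventually_elim (use none in \<open>auto simp: a_def\<close>)
    then have "emeasure \<mu> {\<eta> \<in> space \<mu>. \<phi> \<eta> < l 0} = 0"
      using AE_iff_measurable[of "{\<eta> \<in> space \<mu>. \<phi> \<eta> < l 0}" \<mu> "\<lambda>\<eta>. \<not> \<phi> \<eta> < l 0"] uniform_facts(3) by simp
    then show False using pos by simp
  qed
  then obtain \<eta> where \<eta>: "\<eta> \<in> space \<mu>" "\<phi> \<eta> = a" "a < l 0" by auto
  have "measure \<mu> (good_planes (a - \<alpha>min)) = 1"
  proof -
    have "AE \<eta> in \<mu>. \<eta> \<in> {\<eta> \<in> space \<mu>. \<phi> \<eta> - \<alpha>min \<le> a - \<alpha>min}"
      using ae AE_space by eventually_elim (simp add: a_def)
    moreover have "{\<eta> \<in> space \<mu>. \<phi> \<eta> - \<alpha>min \<le> a - \<alpha>min} \<in> sets \<mu>"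
      using uniform_facts(3) by measurable
    ultimately have "prob {\<eta> \<in> space \<mu>. \<phi> \<eta> - \<alpha>min \<le> a - \<alpha>min} = 1"
      by (simp only: prob_eq_1)
    then show ?thesis by (simp add: good_planes_def uniform_facts(2))
  qed
  then show ?thesis using that[of "a - \<alpha>min"] bounds[OF \<eta>(1)] \<eta> by simp
qed

end

subsection \<open>The samples through a given point\<close>

context
  fixes \<nu> :: "real^'n \<Rightarrow> (real^'n) set measure"
  assumes unif_through: "\<And>z. uniform_grassmannian_through k z (\<nu> z)"
begin

lemma uniform_through_facts:
  "prob_space (\<nu> z)" "space (\<nu> z) = grassmannian_through k z" "\<phi> \<in> borel_measurable (\<nu> z)"
  using unif_through[of z] invariant_prob_facts[of k "grassmannian_through k z" _ "\<nu> z"] plane_min_measurable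
  by (auto simp: uniform_grassmannian_through_def grassmannian_through_def)

lemma gap_ratio_bounds:
  assumes "z \<noteq> 0" and "\<not> \<phi> constant_on grassmannian_through k z"
  defines "R \<equiv> (SUP \<eta>\<in>grassmannian_through k z. \<phi> \<eta>) - \<alpha>min"
  shows "0 < R" and "L2_deviation (\<nu> z) \<phi> \<le> R" and "gap_param k \<nu> l * R \<le> L2_deviation (\<nu> z) \<phi>"
proof -
  have bounds: "\<alpha>min \<le> \<phi> \<eta> \<and> \<phi> \<eta> \<le> \<alpha>min + ((SUP \<eta>\<in>grassmannian_through k w. \<phi> \<eta>) - \<alpha>min)"
    if "\<eta> \<in> space (\<nu> w)" for \<eta> w
    using that SUP_plane_min_through(2)[of \<eta> w]
    by (auto simp: uniform_through_facts grassmannian_through_def alpha_min_le_plane_min)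
  have nonneg: "0 \<le> L2_deviation (\<nu> w) \<phi> / ((SUP \<eta>\<in>grassmannian_through k w. \<phi> \<eta>) - \<alpha>min)" for w
  proof -
    obtain \<zeta> where "\<zeta> \<in> space (\<nu> w)"
      using prob_space.not_empty[OF uniform_through_facts(1)] by blast
    with bounds[of \<zeta> w] show ?thesis by (auto simp: L2_deviation_def L2_norm_def)
  qed
  show "0 < R"
  proof (rule ccontr)
    assume "\<not> 0 < R"
    then have "\<phi> \<eta> = \<alpha>min" if "\<eta> \<in> grassmannian_through k z" for \<eta>
      using bounds[of \<eta> z] that by (simp add: R_def uniform_through_facts)
    then show False using assms(2) by (auto simp: constant_on_def)
  qed
  show "L2_deviation (\<nu> z) \<phi> \<le> R"
    using bounds by (intro prob_space.L2_deviation_le_range[of _ _ "\<alpha>min"] uniform_through_facts)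
      (auto simp: R_def)
  have "gap_param k \<nu> l \<le> L2_deviation (\<nu> z) \<phi> / R"
    unfolding gap_param_def R_def INF_plane_min_through
    using assms(1,2) nonneg by (intro cINF_lower bdd_belowI2[of _ 0]) auto
  then show "gap_param k \<nu> l * R \<le> L2_deviation (\<nu> z) \<phi>"
    using \<open>0 < R\<close> by (simp add: pos_le_divide_eq)
qed

text \<open>
  The infimum defining the gap parameter is bounded by one of its terms, and a deviation never
  exceeds the range. The hypothesis ensures that there is such a term; the infimum of the empty
  set of reals has no specified value.
\<close>
lemma gap_param_le_1:
  assumes "\<alpha>min < \<alpha>max"
  shows "gap_param k \<nu> l \<le> 1"
proof -
  have "\<exists>\<eta>\<in>grassmannian k. \<phi> \<eta> \<noteq> \<alpha>min"
  proof (rule ccontr)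
    assume "\<not> ?thesis"
    moreover obtain \<zeta> where "\<zeta> \<in> grassmannian_through k (0 :: real^'n)"
      by (rule plane_through_point_and_minimizer[of 0])
    ultimately have "\<phi> ` grassmannian k = {\<alpha>min}" by (auto simp: grassmannian_through_def)
    then show False using assms by (simp add: alpha_max_def)
  qed
  then obtain \<eta> where \<eta>: "\<eta> \<in> grassmannian k" "\<phi> \<eta> \<noteq> \<alpha>min" by auto
  then have "dim \<eta> \<noteq> 0" using k by (simp add: grassmannian_def)
  then obtain z where z: "z \<in> \<eta>" "z \<noteq> 0" by (auto simp: dim_eq_0)
  obtain \<zeta> where "\<zeta> \<in> grassmannian_through k z" "\<phi> \<zeta> = \<alpha>min"
    by (rule plane_through_point_and_minimizer)
  moreover have "\<eta> \<in> grassmannian_through k z"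
    using \<eta>(1) z(1) by (simp add: grassmannian_through_def)
  ultimately have "\<not> \<phi> constant_on grassmannian_through k z"
    using \<eta>(2) unfolding constant_on_def by metis
  note ratio = gap_ratio_bounds[OF z(2) this]
  from ratio(3,2) have "gap_param k \<nu> l * ((SUP \<eta>\<in>grassmannian_through k z. \<phi> \<eta>) - \<alpha>min) \<le>
      1 * ((SUP \<eta>\<in>grassmannian_through k z. \<phi> \<eta>) - \<alpha>min)"
    by simp
  then show ?thesis using ratio(1) by (rule mult_right_le_imp_le)
qed

text \<open>
  The plane minimum on planes through \<open>z\<close> ranges between \<open>\<alpha>min\<close> and at most \<open>l z\<close>, so a drop by the
  fraction \<open>\<Theta> / sqrt 2\<close> of its range contracts any bound \<open>c\<close> on the excess loss at \<open>z\<close> by the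
  factor \<open>1 - \<Theta> / sqrt 2\<close>. If \<open>z\<close> is a global minimizer, the plane minimum is constantly \<open>\<alpha>min\<close>.
\<close>
lemma prob_good_gap:
  assumes "0 \<le> gap_param k \<nu> l" and "gap_param k \<nu> l \<le> 1" and "z \<noteq> 0" and c: "l z - \<alpha>min \<le> c"
  defines "\<Theta> \<equiv> gap_param k \<nu> l"
  shows "\<Theta>\<^sup>2 / 2 \<le> measure (\<nu> z) (good_planes ((1 - \<Theta> / sqrt 2) * c) \<inter> space (\<nu> z))"
proof -
  interpret prob_space "\<nu> z" by (rule uniform_through_facts)
  have r: "0 \<le> 1 - \<Theta> / sqrt 2"
    using assms by (simp add: divide_le_eq) (meson order_trans real_sqrt_ge_one one_le_numeral)
  have c0: "0 \<le> c" using c alpha_min_le[of z] by simp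
  have sets: "good_planes a \<inter> space (\<nu> z) \<in> sets (\<nu> z)" for a
    using unif_through[of z] invariant_prob_facts(3)[OF _ _ good_planes_measurable]
    unfolding uniform_through_facts uniform_grassmannian_through_def
    by (auto simp: grassmannian_through_def)
  show ?thesis
  proof (cases "\<phi> constant_on grassmannian_through k z")
    case True
    moreover obtain \<zeta> where "\<zeta> \<in> grassmannian_through k z" "\<phi> \<zeta> = \<alpha>min"
      by (rule plane_through_point_and_minimizer)
    ultimately have "\<phi> \<eta> = \<alpha>min" if "\<eta> \<in> grassmannian_through k z" for \<eta>
      using that unfolding constant_on_def by metis
    then have "good_planes ((1 - \<Theta> / sqrt 2) * c) \<inter> space (\<nu> z) = space (\<nu> z)"
      using r c0 by (auto simp: good_planes_def uniform_through_facts grassmannian_through_def)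
    moreover have "\<Theta>\<^sup>2 \<le> 1" using assms by (simp add: power_le_one)
    ultimately show ?thesis by (simp add: prob_space)
  next
    case False
    define R where "R = (SUP \<eta>\<in>grassmannian_through k z. \<phi> \<eta>) - \<alpha>min"
    note gap = gap_ratio_bounds[OF \<open>z \<noteq> 0\<close> False, folded R_def \<Theta>_def]
    have "R \<le> c" using SUP_plane_min_through(1)[of z] c by (simp add: R_def)
    have "(\<Theta> / sqrt 2)\<^sup>2 \<le> prob {\<eta> \<in> space (\<nu> z). \<phi> \<eta> - \<alpha>min \<le> (1 - \<Theta> / sqrt 2) * R}"
      using assms gap SUP_plane_min_through(2)[of _ z]
      by (intro prob_drop_below_max uniform_through_facts)
        (auto simp: uniform_through_facts R_def grassmannian_through_def alpha_min_le_plane_min)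
    also have "\<dots> \<le> prob (good_planes ((1 - \<Theta> / sqrt 2) * c) \<inter> space (\<nu> z))"
    proof (intro finite_measure_mono sets subsetI)
      fix \<eta> assume "\<eta> \<in> {\<eta> \<in> space (\<nu> z). \<phi> \<eta> - \<alpha>min \<le> (1 - \<Theta> / sqrt 2) * R}"
      then show "\<eta> \<in> good_planes ((1 - \<Theta> / sqrt 2) * c) \<inter> space (\<nu> z)"
        using mult_left_mono[OF \<open>R \<le> c\<close> r]
        by (auto simp: good_planes_def uniform_through_facts grassmannian_through_def)
    qed
    finally show ?thesis by (simp add: power_divide)
  qed
qed

end

end

section \<open>The walk\<close>

locale coercive_random_subspace_walk =
  random_subspace_walk M F k T l B \<mu> \<nu> x0 \<eta> x + coercive_loss l k
  for M :: "'w measure" and F k T and l :: "real^'n \<Rightarrow> real" and B \<mu> \<nu> x0 \<eta> x +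
  assumes T_pos: "T \<ge> 1"
    and unif: "uniform_grassmannian k \<mu>"
    and unif_through: "\<And>z. uniform_grassmannian_through k z (\<nu> z)"
    and black_box: "\<And>\<zeta>. \<zeta> \<in> grassmannian k \<Longrightarrow> is_arg_min l (\<lambda>y. y \<in> \<zeta>) (B \<zeta>)"
begin

lemma loss_black_box: "\<zeta> \<in> grassmannian k \<Longrightarrow> l (B \<zeta>) = \<phi> \<zeta>"
  using black_box[of \<zeta>] unfolding plane_min_def is_arg_min_linorder
  by (intro cInf_eq_minimum[symmetric]) auto

lemma sample_is_plane: "j < T \<Longrightarrow> \<omega> \<in> space M \<Longrightarrow> \<eta> (Suc i) j \<omega> \<in> grassmannian k"
  using measurable_space[OF measurable_\<eta>, of j \<omega> i] by (simp add: space_F)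

lemma next_loss_le:
  assumes "j < T" and "\<omega> \<in> space M"
  shows "l (x (Suc i) \<omega>) \<le> \<phi> (\<eta> (Suc i) j \<omega>)"
proof -
  have "l (x (Suc i) \<omega>) \<le> l (B (\<eta> (Suc i) j \<omega>))"
    using choice[OF assms(2), of i] assms(1) unfolding is_arg_min_linorder by auto
  then show ?thesis using loss_black_box[OF sample_is_plane[OF assms]] by simp
qed

lemma loss_event_measurable: "{\<omega> \<in> space M. l (x i \<omega>) - \<alpha>min \<le> c} \<in> sets (F i)"
proof -
  have [measurable]: "(\<lambda>\<omega>. l (x i \<omega>)) \<in> borel_measurable (F i)"
    by (rule measurable_compose[OF measurable_x loss_measurable])
  have "{\<omega> \<in> space (F i). l (x i \<omega>) - \<alpha>min \<le> c} \<in> sets (F i)" by measurable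
  then show ?thesis by (simp add: space_F)
qed

lemma sets_F_M: "A \<in> sets (F i) \<Longrightarrow> A \<in> sets M"
  using subalgebra_F[of i] by (auto simp: subalgebra_def)

text \<open>
  The batch misses the target \<open>c\<close> only if all \<open>T\<close> planes are bad, which by conditional independence
  has conditional probability at most \<open>(1 - q) ^ T\<close>. Keeping the target deterministic, although
  the conditional law depends on the current point, allows the defining identity of the samples to
  be applied with one fixed set of planes.
\<close>
lemma batch_succeeds:
  assumes H: "H \<in> sets (F i)" and iid: "sampled_iid M (F i) k T \<kappa> (\<eta> (Suc i))"
    and \<kappa>: "\<And>\<omega>. \<omega> \<in> H \<Longrightarrow> invariant_prob k (X \<omega>) (G \<omega>) (\<kappa> \<omega>)"
    and X: "\<And>\<omega>. \<omega> \<in> H \<Longrightarrow> X \<omega> \<subseteq> grassmannian k"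
    and q: "\<And>\<omega>. \<omega> \<in> H \<Longrightarrow> q \<le> measure (\<kappa> \<omega>) (good_planes c \<inter> space (\<kappa> \<omega>))" and "q \<le> 1"
  shows "(1 - (1 - q) ^ T) * prob H \<le> prob {\<omega> \<in> H. l (x (Suc i) \<omega>) - \<alpha>min \<le> c}"
proof -
  define bad where "bad = grassmannian k - good_planes c"
  define miss where "miss = H \<inter> {\<omega> \<in> space M. \<forall>j<T. \<eta> (Suc i) j \<omega> \<in> bad}"
  define hit where "hit = {\<omega> \<in> H. l (x (Suc i) \<omega>) - \<alpha>min \<le> c}"
  have H_M: "H \<in> sets M" "H \<subseteq> space M"
    using sets_F_M[OF H] sets.sets_into_space by blast+
  have bad: "bad \<in> sets (grassmannian_borel k)"
    using good_planes_measurable sets.top[of "grassmannian_borel k"] unfolding bad_def by auto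
  have hit: "hit \<in> sets M"
  proof -
    have "hit = H \<inter> {\<omega> \<in> space M. l (x (Suc i) \<omega>) - \<alpha>min \<le> c}"
      using H_M by (auto simp: hit_def)
    then show ?thesis using H_M(1) sets_F_M[OF loss_event_measurable] by (simp add: sets.Int)
  qed
  have "\<eta> (Suc i) j -` bad \<inter> space M \<in> sets M" if "j < T" for j
    using sets_F_M[OF measurable_sets[OF measurable_\<eta>[OF that, of i] bad]] by (simp add: space_F)
  moreover have "0 \<in> {..<T}" using T_pos by simp
  ultimately have "(\<Inter>j<T. \<eta> (Suc i) j -` bad \<inter> space M) \<in> sets M"
    by (intro sets.finite_INT) auto
  moreover have "miss = H \<inter> (\<Inter>j<T. \<eta> (Suc i) j -` bad \<inter> space M)"
    using T_pos H_M by (auto simp: miss_def)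
  ultimately have miss: "miss \<in> sets M" using H_M by auto
  have bad_prob: "emeasure (\<kappa> \<omega>) (bad \<inter> space (\<kappa> \<omega>)) \<le> ennreal (1 - q)" if "\<omega> \<in> H" for \<omega>
  proof -
    note facts = invariant_prob_facts[OF \<kappa>[OF that] X[OF that]]
    interpret K: prob_space "\<kappa> \<omega>" by (rule facts)
    have "bad \<inter> space (\<kappa> \<omega>) = space (\<kappa> \<omega>) - good_planes c \<inter> space (\<kappa> \<omega>)"
      using X[OF that] facts(2) by (auto simp: bad_def)
    then have "K.prob (bad \<inter> space (\<kappa> \<omega>)) = 1 - K.prob (good_planes c \<inter> space (\<kappa> \<omega>))"
      using K.prob_compl facts(3)[OF good_planes_measurable] facts(2) by simp
    then show ?thesis
      using q[OF that] by (simp add: K.emeasure_eq_measure ennreal_leI)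
  qed
  have "emeasure M miss = (\<integral>\<^sup>+\<omega>\<in>H. (\<Prod>j<T. emeasure (\<kappa> \<omega>) (bad \<inter> space (\<kappa> \<omega>))) \<partial>M)"
    using iid[unfolded sampled_iid_def, rule_format, OF H, of "\<lambda>_. bad"] bad
    by (simp add: miss_def)
  also have "\<dots> \<le> (\<integral>\<^sup>+\<omega>. ennreal ((1 - q) ^ T) * indicator H \<omega> \<partial>M)"
  proof (rule nn_integral_mono)
    fix \<omega>
    show "(\<Prod>j<T. emeasure (\<kappa> \<omega>) (bad \<inter> space (\<kappa> \<omega>))) * indicator H \<omega> \<le> ennreal ((1 - q) ^ T) * indicator H \<omega>"
      using bad_prob[of \<omega>] \<open>q \<le> 1\<close>
      by (cases "\<omega> \<in> H") (auto simp: ennreal_power[symmetric] intro!: power_mono)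
  qed
  also have "\<dots> = ennreal ((1 - q) ^ T * prob H)"
    using H_M \<open>q \<le> 1\<close> by (simp add: nn_integral_cmult_indicator emeasure_eq_measure ennreal_mult)
  finally have miss_prob: "prob miss \<le> (1 - q) ^ T * prob H"
    using \<open>q \<le> 1\<close> by (simp add: emeasure_eq_measure)
  have "H \<subseteq> hit \<union> miss"
  proof
    fix \<omega> assume \<omega>: "\<omega> \<in> H"
    show "\<omega> \<in> hit \<union> miss"
    proof (cases "\<forall>j<T. \<eta> (Suc i) j \<omega> \<in> bad")
      case True
      then show ?thesis using \<omega> H_M by (auto simp: miss_def)
    next
      case False
      then obtain j where j: "j < T" "\<eta> (Suc i) j \<omega> \<notin> bad" by auto
      then have "\<phi> (\<eta> (Suc i) j \<omega>) - \<alpha>min \<le> c"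
        using sample_is_plane[OF j(1), of \<omega> i] \<omega> H_M by (auto simp: bad_def good_planes_def)
      then show ?thesis using next_loss_le[OF j(1), of \<omega> i] \<omega> H_M by (auto simp: hit_def)
    qed
  qed
  then have "prob H \<le> prob (hit \<union> miss)" using hit miss by (intro finite_measure_mono) auto
  also have "\<dots> \<le> prob hit + prob miss" using hit miss by (rule measure_Un_le)
  finally show ?thesis using miss_prob by (simp add: hit_def algebra_simps)
qed

definition below_geometric :: "real \<Rightarrow> real \<Rightarrow> nat \<Rightarrow> 'w set" where
  "below_geometric r b n = {\<omega> \<in> space M. \<forall>m\<le>n. l (x (m + 1) \<omega>) - \<alpha>min \<le> r ^ m * b}"

lemma below_geometric_measurable: "below_geometric r b n \<in> sets (F (Suc n))"
proof -
  have "{\<omega> \<in> space M. l (x (m + 1) \<omega>) - \<alpha>min \<le> r ^ m * b} \<in> sets (F (Suc n))" if "m \<le> n" for m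
    using loss_event_measurable[of "m + 1"] sets_F_mono[of "m + 1" "Suc n"] that by auto
  then have "(\<Inter>m\<le>n. {\<omega> \<in> space M. l (x (m + 1) \<omega>) - \<alpha>min \<le> r ^ m * b}) \<in> sets (F (Suc n))"
    by (intro sets.finite_INT) auto
  moreover have "below_geometric r b n = (\<Inter>m\<le>n. {\<omega> \<in> space M. l (x (m + 1) \<omega>) - \<alpha>min \<le> r ^ m * b})"
    by (auto simp: below_geometric_def)
  ultimately show ?thesis by simp
qed

text \<open>
  Induction over the batches. The contraction is available only away from the origin, because the
  gap parameter does not look at the origin. On the event of the induction hypothesis the current
  loss is at most \<open>\<alpha>min + b\<close>, hence strictly less than the loss at the origin, so the walk is not
  there.
\<close>
lemma prob_below_geometric:
  assumes r: "0 \<le> r" "r \<le> 1" and b: "0 \<le> b" "b < l 0 - \<alpha>min"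
    and p: "p \<le> measure \<mu> (good_planes b)" "p \<le> 1" and q: "0 \<le> q" "q \<le> 1"
    and contraction: "\<And>z c. z \<noteq> 0 \<Longrightarrow> l z - \<alpha>min \<le> c \<Longrightarrow>
      q \<le> measure (\<nu> z) (good_planes (r * c) \<inter> space (\<nu> z))"
  shows "(1 - (1 - p) ^ T) * (1 - (1 - q) ^ T) ^ n \<le> prob (below_geometric r b n)"
proof (induction n)
  case 0
  have "(1 - (1 - p) ^ T) * prob (space M) \<le> prob {\<omega> \<in> space M. l (x (Suc 0) \<omega>) - \<alpha>min \<le> b}"
  proof (rule batch_succeeds)
    show "space M \<in> sets (F 0)" using sets.top[of "F 0"] by (simp add: space_F)
    show "sampled_iid M (F 0) k T (\<lambda>\<omega>. \<mu>) (\<eta> (Suc 0))" using first_batch by simp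
    show "invariant_prob k (grassmannian k) {f. orthogonal_transformation f} \<mu>"
      using unif by (simp add: uniform_grassmannian_def)
    have "good_planes b \<inter> space \<mu> = good_planes b"
      by (auto simp: uniform_facts[OF unif] good_planes_def)
    then show "p \<le> measure \<mu> (good_planes b \<inter> space \<mu>)" using p by simp
  qed (use p in auto)
  then show ?case by (simp add: below_geometric_def prob_space)
next
  case (Suc n)
  have "(1 - (1 - q) ^ T) * prob (below_geometric r b n) \<le>
    prob {\<omega> \<in> below_geometric r b n. l (x (Suc (Suc n)) \<omega>) - \<alpha>min \<le> r * (r ^ n * b)}"
  proof (rule batch_succeeds)
    show "below_geometric r b n \<in> sets (F (Suc n))" by (rule below_geometric_measurable)
    show "sampled_iid M (F (Suc n)) k T (\<lambda>\<omega>. \<nu> (x (Suc n) \<omega>)) (\<eta> (Suc (Suc n)))"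
      by (rule next_batch) simp
    fix \<omega> assume \<omega>: "\<omega> \<in> below_geometric r b n"
    show "invariant_prob k (grassmannian_through k (x (Suc n) \<omega>))
        {f. orthogonal_transformation f \<and> f (x (Suc n) \<omega>) = x (Suc n) \<omega>} (\<nu> (x (Suc n) \<omega>))"
      using unif_through by (simp add: uniform_grassmannian_through_def)
    have loss: "l (x (Suc n) \<omega>) - \<alpha>min \<le> r ^ n * b"
      using \<omega> by (auto simp: below_geometric_def)
    also have "\<dots> \<le> b" using r b by (simp add: mult_left_le_one_le power_le_one)
    finally have "x (Suc n) \<omega> \<noteq> 0" using b by auto
    then show "q \<le> measure (\<nu> (x (Suc n) \<omega>)) (good_planes (r * (r ^ n * b)) \<inter> space (\<nu> (x (Suc n) \<omega>)))"
      by (rule contraction[OF _ loss])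
  qed (use q in \<open>auto simp: grassmannian_through_def\<close>)
  also have "{\<omega> \<in> below_geometric r b n. l (x (Suc (Suc n)) \<omega>) - \<alpha>min \<le> r * (r ^ n * b)} =
      below_geometric r b (Suc n)"
    by (auto simp: below_geometric_def le_Suc_eq mult.assoc)
  finally have "(1 - (1 - q) ^ T) * prob (below_geometric r b n) \<le> prob (below_geometric r b (Suc n))" .
  moreover have "0 \<le> 1 - (1 - q) ^ T" using q by (simp add: power_le_one)
  ultimately show ?case
    using mult_left_mono[OF Suc.IH, of "1 - (1 - q) ^ T"] by (simp add: mult_ac)
qed

text \<open>
  For a constant plane minimum every batch, the first one included, already finds the global
  minimum.
\<close>
lemma loss_minimal_if_alpha_eq:
  assumes "\<alpha>max = \<alpha>min" and "\<omega> \<in> space M"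
  shows "l (x (Suc i) \<omega>) = \<alpha>min"
proof -
  have "l (x (Suc i) \<omega>) \<le> \<phi> (\<eta> (Suc i) 0 \<omega>)" using next_loss_le[of 0] T_pos assms by simp
  also have "\<dots> \<le> \<alpha>max"
    using sample_is_plane[of 0] T_pos assms by (intro plane_min_le_alpha_max) simp
  finally show ?thesis using assms(1) alpha_min_le[of "x (Suc i) \<omega>"] by simp
qed

end

section \<open>Exit time and sample size\<close>

lemma exit_index_le:
  assumes "1 \<le> i" and "l (y (i - 1)) - l (y i) \<le> \<epsilon>"
  shows "1 \<le> exit_index l \<epsilon> y" and "exit_index l \<epsilon> y \<le> i"
proof -
  let ?P = "\<lambda>i. i \<ge> 1 \<and> \<not> (l (y (i - 1)) - l (y i) > \<epsilon>)"
  have "?P i" using assms by simp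
  then show "exit_index l \<epsilon> y \<le> i" unfolding exit_index_def by (rule Least_le)
  from \<open>?P i\<close> have "?P (exit_index l \<epsilon> y)" unfolding exit_index_def by (rule LeastI)
  then show "1 \<le> exit_index l \<epsilon> y" by simp
qed

lemma power_le_if_ln_quotient_le:
  fixes a c :: real
  assumes "0 < a" "a < 1" "0 < c" and "ln c / ln a \<le> real n"
  shows "a ^ n \<le> c"
proof -
  have "ln a < 0" using assms by simp
  then have "real n * ln a \<le> ln c" using assms(4) by (simp add: neg_divide_le_eq)
  then have "ln (a ^ n) \<le> ln c" using assms(1) by (simp add: ln_realpow)
  then show ?thesis using assms by simp
qed

text \<open>
  The sample size makes each of \<open>n\<close> batches succeed with probability at least
  \<open>2 powr (-1 / (2 n))\<close>, whose \<open>n\<close>-th power is \<open>1 / sqrt 2\<close>.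
\<close>
lemma success_probability_power:
  fixes q :: real
  assumes "0 < q" "q < 1" "1 \<le> n"
    and "ln (1 - 2 powr (-1 / (2 * real n))) / ln (1 - q) \<le> real T"
  shows "1 / sqrt 2 \<le> (1 - (1 - q) ^ T) ^ n"
proof -
  define s :: real where "s = 2 powr (-1 / (2 * real n))"
  have s: "0 < s" "s < 1" using assms(3) by (auto simp: s_def powr_less_one)
  have "(1 - q) ^ T \<le> 1 - s"
    using assms s by (intro power_le_if_ln_quotient_le) (auto simp: s_def)
  then have "s ^ n \<le> (1 - (1 - q) ^ T) ^ n" using s by (intro power_mono) auto
  moreover have "s ^ n = 2 powr (-1/2)"
    using assms(3) by (simp add: s_def powr_realpow[symmetric] powr_powr)
  moreover have "(2::real) powr (-1/2) = 1 / sqrt 2"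
    by (simp add: powr_minus_divide powr_half_sqrt)
  ultimately show ?thesis by simp
qed

theorem theorem3:
  fixes l :: "real^'n \<Rightarrow> real"
    and k T :: nat
    and \<epsilon> \<delta> \<Theta> \<alpha>max \<alpha>min :: real
    and B :: "(real^'n) set \<Rightarrow> real^'n"
    and \<mu> :: "(real^'n) set measure"
    and \<nu> :: "real^'n \<Rightarrow> (real^'n) set measure"
    and M :: "'w measure"
    and F :: "nat \<Rightarrow> 'w measure"
    and x0 :: "real^'n"
    and \<eta> :: "nat \<Rightarrow> nat \<Rightarrow> 'w \<Rightarrow> (real^'n) set"
    and x :: "nat \<Rightarrow> 'w \<Rightarrow> real^'n"
    and loss_bound :: "nat \<Rightarrow> real"
    and success :: "nat \<Rightarrow> 'w set"
  assumes "1 < k" and "k < CARD('n)"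
    and "T \<ge> 1" and "\<epsilon> > 0"
    and "continuous_on UNIV l" and "coercive l"
    and "uniform_grassmannian k \<mu>"
    and "\<And>z. uniform_grassmannian_through k z (\<nu> z)"
    and "\<And>\<zeta>. \<zeta> \<in> grassmannian k \<Longrightarrow> is_arg_min l (\<lambda>y. y \<in> \<zeta>) (B \<zeta>)"
    and "random_subspace_walk M F k T l B \<mu> \<nu> x0 \<eta> x"
    and "\<alpha>max = alpha_max k l" and "\<alpha>min = alpha_min k l"
    and "\<delta> = delta_param k \<mu> l" and "\<Theta> = gap_param k \<nu> l"
    and "\<Theta> > 0"
    and "\<And>n. loss_bound n = (1 - \<delta>) * (1 - 2 powr (-1/2) * \<Theta>) ^ n * (\<alpha>max - \<alpha>min)"
    and "\<And>n. success n = {\<omega>\<in>space M. \<forall>m\<le>n. l (x (m + 1) \<omega>) - \<alpha>min \<le> loss_bound m}"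
  shows "(\<forall>n. (1 - (1 - \<delta>\<^sup>2) ^ T) * (1 - (1 - \<Theta>\<^sup>2 / 2) ^ T) ^ n \<le> measure M (success n)) \<and>
         (\<forall>n\<ge>1. \<forall>\<omega>\<in>success n.
           l (x n \<omega>) - l (x (n + 1) \<omega>) = (l (x n \<omega>) - \<alpha>min) - (l (x (n + 1) \<omega>) - \<alpha>min) \<and>
           (l (x n \<omega>) - \<alpha>min) - (l (x (n + 1) \<omega>) - \<alpha>min) \<le> l (x n \<omega>) - \<alpha>min \<and>
           l (x n \<omega>) - \<alpha>min \<le> loss_bound (n - 1)) \<and>
         (\<forall>n\<ge>1. int n = \<lceil>ln (\<epsilon> / ((1 - \<delta>) * (\<alpha>max - \<alpha>min))) / ln (1 - 2 powr (-1/2) * \<Theta>)\<rceil> + 1 \<longrightarrow>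
           (\<forall>\<omega>\<in>success n. \<exists>m\<le>n.
              exit_index l \<epsilon> (\<lambda>i. x i \<omega>) = m + 1 \<and>
              l (x (exit_index l \<epsilon> (\<lambda>i. x i \<omega>)) \<omega>) - \<alpha>min \<le> loss_bound m)) \<and>
         (\<forall>n\<ge>1. int T = \<lceil>max (ln (1 - 1 / sqrt 2) / ln (1 - \<delta>\<^sup>2))
                             (ln (1 - 2 powr (-1 / (2 * real n))) / ln (1 - \<Theta>\<^sup>2 / 2))\<rceil> \<longrightarrow>
           1 / 2 \<le> measure M (success n))"
proof -
  interpret coercive_random_subspace_walk M F k T l B \<mu> \<nu> x0 \<eta> x
    using assms(1-10)
    by (intro coercive_random_subspace_walk.intro coercive_loss.intro coercive_random_subspace_walk_axioms.intro) auto
  have \<alpha>_eqs: "\<alpha>max = alpha_max k l" "\<alpha>min = alpha_min k l" by (fact assms)+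
  have \<delta>_eq: "\<delta> = delta_param k \<mu> l" and \<Theta>_eq: "\<Theta> = gap_param k \<nu> l" by (fact assms)+
  define r where "r = 1 - \<Theta> / sqrt 2"
  define D where "D = \<alpha>max - \<alpha>min"
  have "(2::real) powr (-1/2) = 1 / sqrt 2" by (simp add: powr_minus_divide powr_half_sqrt)
  then have r_eq: "1 - 2 powr (-1/2) * \<Theta> = r" by (simp only: r_def) simp
  have bound_eq: "loss_bound m = r ^ m * ((1 - \<delta>) * D)" for m
    using assms(16)[of m] unfolding r_eq D_def by simp
  have success_eq: "success n = below_geometric r ((1 - \<delta>) * D) n" for n
    using assms(17)[of n] by (simp add: below_geometric_def bound_eq \<alpha>_eqs)
  have success_D: "l (x (m + 1) \<omega>) - \<alpha>min \<le> loss_bound m" if "\<omega> \<in> success n" "m \<le> n" for \<omega> m n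
    using that assms(17)[of n] by simp
  have min_le: "\<alpha>min \<le> l z" for z using alpha_min_le by (simp add: \<alpha>_eqs)
  obtain \<zeta> :: "(real^'n) set" where "\<zeta> \<in> grassmannian k"
    using plane_through_two_points[of k "0 :: real^'n" 0] k by auto
  then have "\<alpha>min \<le> \<alpha>max"
    using alpha_min_le_plane_min plane_min_le_alpha_max unfolding \<alpha>_eqs by fastforce
  have success_chain: "\<forall>n\<ge>1. \<forall>\<omega>\<in>success n.
      l (x n \<omega>) - l (x (n + 1) \<omega>) = (l (x n \<omega>) - \<alpha>min) - (l (x (n + 1) \<omega>) - \<alpha>min) \<and>
      (l (x n \<omega>) - \<alpha>min) - (l (x (n + 1) \<omega>) - \<alpha>min) \<le> l (x n \<omega>) - \<alpha>min \<and>
      l (x n \<omega>) - \<alpha>min \<le> loss_bound (n - 1)"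
  proof (intro allI impI ballI conjI)
    fix n :: nat and \<omega> assume "1 \<le> n" "\<omega> \<in> success n"
    then show "l (x n \<omega>) - \<alpha>min \<le> loss_bound (n - 1)" using success_D[of \<omega> n "n - 1"] by simp
  qed (use min_le in auto)
  have exits: "\<exists>m\<le>n. exit_index l \<epsilon> (\<lambda>i. x i \<omega>) = m + 1 \<and>
      l (x (exit_index l \<epsilon> (\<lambda>i. x i \<omega>)) \<omega>) - \<alpha>min \<le> loss_bound m"
    if "\<omega> \<in> success n" and "1 \<le> n" and small: "loss_bound (n - 1) \<le> \<epsilon>" for n \<omega>
  proof -
    have "l (x (n + 1 - 1) \<omega>) - l (x (n + 1) \<omega>) \<le> \<epsilon>"
      using success_chain[rule_format, OF that(2,1)] small by auto
    then have "1 \<le> exit_index l \<epsilon> (\<lambda>i. x i \<omega>)" "exit_index l \<epsilon> (\<lambda>i. x i \<omega>) \<le> n + 1"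
      using exit_index_le[of "n + 1" l "\<lambda>i. x i \<omega>" \<epsilon>] by auto
    then obtain m where "m \<le> n" "exit_index l \<epsilon> (\<lambda>i. x i \<omega>) = m + 1"
      by (metis add.commute add_le_cancel_right le_Suc_ex)
    then show ?thesis using success_D[OF that(1)] by auto
  qed
  show ?thesis
  proof (cases "\<alpha>min = \<alpha>max")
    case True
    have "\<delta> = 0" using True unfolding \<delta>_eq delta_param_def \<alpha>_eqs by simp
    \<comment> \<open>In this case \<open>\<Theta>\<close> is the infimum of an empty set, so \<open>r\<close> need not lie between \<open>0\<close> and
        \<open>1\<close>; all bounds vanish, and so does the excess loss after every batch.\<close>
    have bound_0: "loss_bound m = 0" for m using True by (simp add: bound_eq D_def)
    have "success n = space M" for n
      using assms(17)[of n] loss_minimal_if_alpha_eq True by (auto simp: \<alpha>_eqs bound_0[unfolded \<alpha>_eqs])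
    then have "measure M (success n) = 1" for n by (simp add: prob_space)
    then show ?thesis
      using success_chain exits bound_0 \<open>\<delta> = 0\<close> \<open>\<epsilon> > 0\<close> by simp
  next
    case False
    then have less: "alpha_min k l < alpha_max k l" and "0 < D"
      using \<open>\<alpha>min \<le> \<alpha>max\<close> by (auto simp: \<alpha>_eqs D_def)
    have \<delta>: "0 \<le> \<delta>" "\<delta> < 1"
      using delta_param_nonneg[OF unif less] delta_param_less_1[OF unif less] by (auto simp: \<delta>_eq)
    have \<Theta>: "0 < \<Theta>" "\<Theta> \<le> 1"
      using gap_param_le_1[OF unif_through less] \<open>\<Theta> > 0\<close> by (auto simp: \<Theta>_eq)
    have "\<Theta> / sqrt 2 < 1" using \<Theta> by (simp add: divide_less_eq) (smt (verit) real_sqrt_gt_1_iff)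
    then have r: "0 < r" "r < 1" using \<Theta> by (auto simp: r_def)
    have q: "0 < \<Theta>\<^sup>2 / 2" "\<Theta>\<^sup>2 / 2 < 1" using \<Theta> power_le_one[of \<Theta> 2] by auto
    have \<delta>2: "\<delta>\<^sup>2 < 1" using \<delta> by (simp add: abs_square_less_1)
    have contraction: "\<Theta>\<^sup>2 / 2 \<le> measure (\<nu> z) (good_planes (r * c) \<inter> space (\<nu> z))"
      if "z \<noteq> 0" "l z - alpha_min k l \<le> c" for z c
      using prob_good_gap[OF unif_through _ _ that] \<Theta> by (simp add: r_def \<Theta>_eq)
    have D_le: "D \<le> l 0 - alpha_min k l" using alpha_max_le_origin by (simp add: D_def \<alpha>_eqs)
    have prob_success: "(1 - (1 - \<delta>\<^sup>2) ^ T) * (1 - (1 - \<Theta>\<^sup>2 / 2) ^ T) ^ n \<le> measure M (success n)"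
      if "0 < \<delta>" for n
      unfolding success_eq
    proof (rule prob_below_geometric)
      have "(1 - \<delta>) * D < D" using that \<open>0 < D\<close> by simp
      then show "(1 - \<delta>) * D < l 0 - alpha_min k l" using D_le by simp
      show "\<delta>\<^sup>2 \<le> measure \<mu> (good_planes ((1 - \<delta>) * D))"
        using prob_good_delta[OF unif less] by (simp add: \<delta>_eq D_def \<alpha>_eqs)
    qed (use r \<delta> q \<delta>2 \<open>0 < D\<close> contraction in auto)
    have part1: "(1 - (1 - \<delta>\<^sup>2) ^ T) * (1 - (1 - \<Theta>\<^sup>2 / 2) ^ T) ^ n \<le> measure M (success n)" for n
      using prob_success[of n] \<delta> by (cases "\<delta> = 0") auto
    have part3: "loss_bound (n - 1) \<le> \<epsilon>"
      if "1 \<le> n" "int n = \<lceil>ln (\<epsilon> / ((1 - \<delta>) * (\<alpha>max - \<alpha>min))) / ln r\<rceil> + 1" for n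
    proof -
      have pos: "0 < (1 - \<delta>) * D" using \<delta> \<open>0 < D\<close> by simp
      have "ln (\<epsilon> / ((1 - \<delta>) * D)) / ln r \<le> real (n - 1)"
        using that unfolding D_def by linarith
      then have "r ^ (n - 1) \<le> \<epsilon> / ((1 - \<delta>) * D)"
        using r pos \<open>\<epsilon> > 0\<close> by (intro power_le_if_ln_quotient_le) auto
      then show ?thesis using pos by (simp add: bound_eq pos_le_divide_eq)
    qed
    have part4: "1 / 2 \<le> measure M (success n)"
      if "1 \<le> n" and T_eq: "int T = \<lceil>max (ln (1 - 1 / sqrt 2) / ln (1 - \<delta>\<^sup>2))
          (ln (1 - 2 powr (-1 / (2 * real n))) / ln (1 - \<Theta>\<^sup>2 / 2))\<rceil>" for n
    proof -
      let ?first = "1 - (1 - \<delta>\<^sup>2) ^ T" and ?later = "1 - (1 - \<Theta>\<^sup>2 / 2) ^ T"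
      have T_ge: "ln (1 - 1 / sqrt 2) / ln (1 - \<delta>\<^sup>2) \<le> real T"
          "ln (1 - 2 powr (-1 / (2 * real n))) / ln (1 - \<Theta>\<^sup>2 / 2) \<le> real T"
        using T_eq by linarith+
      have walk: "1 / sqrt 2 \<le> ?later ^ n" using q \<open>1 \<le> n\<close> T_ge(2) by (rule success_probability_power)
      show ?thesis
      proof (cases "\<delta> = 0")
        case False
        have "(1 - \<delta>\<^sup>2) ^ T \<le> 1 - 1 / sqrt 2"
          using False \<delta>2 T_ge(1) by (intro power_le_if_ln_quotient_le) auto
        then have "1 / sqrt 2 \<le> ?first" by simp
        moreover from this have "0 \<le> ?first" by (rule order_trans[rotated]) simp
        ultimately have "1 / sqrt 2 * (1 / sqrt 2) \<le> ?first * ?later ^ n"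
          using walk by (intro mult_mono[of _ ?first _ "?later ^ n"]) simp_all
        then show ?thesis using part1[of n] by simp
      next
        case True
        \<comment> \<open>The ratio of logarithms for the first batch is \<open>0\<close> here; instead of a bound from \<open>T\<close>, the
            almost sure excess \<open>c\<close> starts the chain with probability one.\<close>
        obtain c where c: "0 \<le> c" "c \<le> D" "c < l 0 - alpha_min k l" "measure \<mu> (good_planes c) = 1"
          using degenerate_delta[OF unif less] True unfolding \<delta>_eq D_def \<alpha>_eqs by metis
        have "1 / 2 \<le> 1 / sqrt (2::real)" by (simp add: real_le_lsqrt)
        also have "\<dots> \<le> (1 - (1 - 1) ^ T) * ?later ^ n" using walk T_pos by (simp add: power_0_left)
        also have "\<dots> \<le> prob (below_geometric r c n)"
          using r c q contraction by (intro prob_below_geometric) auto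
        also have "\<dots> \<le> prob (success n)"
        proof (rule finite_measure_mono)
          show "success n \<in> sets M"
            unfolding success_eq using below_geometric_measurable by (rule sets_F_M)
          have "r ^ m * c \<le> r ^ m * ((1 - \<delta>) * D)" for m
            using c True r by (intro mult_left_mono) auto
          then show "below_geometric r c n \<subseteq> success n"
            unfolding success_eq below_geometric_def by (auto intro: order_trans)
        qed
        finally show ?thesis .
      qed
    qed
    show ?thesis
      unfolding r_eq using part1 success_chain exits part3 part4 by blast
  qed
qed

end
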